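(* Let $\bar C\in\mathbb{S}^n$, $A_i\in\mathbb{S}^n$, $b_i\in\mathbb{R}$ ($i\in[m]$) and $k$ be such that, with objective matrix $C=\bar C$, $\operatorname{val}(D)=\operatorname{val}(Q)=\operatorname{val}(P)$. Let $\bar x$ be optimal for (P) and let $(\bar\lambda,\bar Z)$ be optimal for (D), both with objective matrix $\bar C$. Suppose that: (a) $\bar x$ has exactly $k$ nonzero entries; (b) the Abadie constraint qualification (ACQ) holds at $\bar x$ for $\mathbf{X}_{\operatorname{supp}(\bar x)}$; (c) $\bar Z=0$; (d) $\bar Q:=\bar C-\sum_{i=1}^m\bar\lambda_iA_i$ has corank one. Then (Q) is locally stable near $\bar C$.
   Context: $\mathbb{S}^n$ is the space of real symmetric $n\times n$ matrices, $A\bullet B=\operatorname{Tr}(B^TA)$, $A\succeq B$ means $A-B$ is positive semidefinite, $\operatorname{diag}(X)$ is the diagonal matrix with the same diagonal as $X$, and $\|x\|_0$ is the number of nonzero entries of $x$. Let $\mathcal{S}_{n,k}=\{X\in\mathbb{S}^n: k\operatorname{diag}(X)\succeq X\succeq 0\}$ and $Q_{n,k}=\{xx^T:x\in\mathbb{R}^n,\|x\|_0\le k\}$. The data $A_i,b_i$ ($i\in[m]$) and $k$ are fixed. For an objective matrix $C\in\mathbb{S}^n$ consider: (P): $\min_{x\in\mathbb{R}^n} x^TCx$ s.t. $\|x\|_0\le k$, $x^TA_ix=b_i$, $i\in[m]$; (Q): $\min_{X\in\mathbb{S}^n} C\bullet X$ s.t. $A_i\bullet X=b_i$, $i\in[m]$,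 $X\in\mathcal{S}_{n,k}$; (D), the dual of (Q): $\max_{\lambda\in\mathbb{R}^m,Z\in\mathbb{S}^n}\sum_i\lambda_ib_i$ s.t. $C-\sum_{i=1}^m\lambda_iA_i-(k\operatorname{diag}(Z)-Z)\succeq0$, $Z\succeq0$. $\operatorname{val}(\cdot)$ denotes the optimal value. The relaxation (Q) is exact (for a given $C$) if every optimal solution of (Q) lies in $Q_{n,k}$, i.e. has the form $xx^T$ with $\|x\|_0\le k$, and hence $\operatorname{val}(Q)=\operatorname{val}(P)$. (Q) is locally stable near $\bar C$ if there is a neighborhood of $\bar C$ in $\mathbb{S}^n$ such that (Q) is exact for every objective matrix $C$ in that neighborhood. Let $g(x)=(x^TA_ix-b_i)_{i\in[m]}\in\mathbb{R}^m$, and for $S=\operatorname{supp}(\bar x)$ let $\mathbf{X}_{S}=\{x\in\mathbb{R}^n: g(x)=0,\ x_i=0\ \forall i\notin S\}$, viewed as a subset of the coordinate subspace $\mathbb{R}^S$. Let $g_S:\mathbb{R}^S\to\mathbb{R}^m$ be the restriction of $g$ to the variables in $S$ (the others set to zero). ACQ holds at $\bar x$ for $\mathbf{X}_S$ if $\mathbf{X}_S$ is a smooth manifold near $\bar x$ and $\operatorname{rank}(\nabla g_S(\bar x_S))=\operatorname{codim}_{\bar x}(\mathbf{X}_S)$, the codimension being taken in $\mathbb{R}^S$. *)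

theory Defs
  imports "HOL-Analysis.Analysis"
begin

section \<open>Matrices\<close>

definition sym_mats :: "(real^'n^'n) set" where
  "sym_mats = {X. transpose X = X}"

definition frob :: "real^'n^'n \<Rightarrow> real^'n^'n \<Rightarrow> real"  (infixl "\<bullet>\<^sub>F" 70) where
  "A \<bullet>\<^sub>F B = trace (transpose B ** A)"

definition psd :: "real^'n^'n \<Rightarrow> bool" where
  "psd X \<longleftrightarrow> X \<in> sym_mats \<and> (\<forall>v. 0 \<le> v \<bullet> (X *v v))"

definition psd_ge :: "real^'n^'n \<Rightarrow> real^'n^'n \<Rightarrow> bool"  (infix "\<succeq>" 50) where
  "A \<succeq> B \<longleftrightarrow> psd (A - B)"

definition diag_part :: "real^'n^'n \<Rightarrow> real^'n^'n" where
  "diag_part X = (\<chi> i j. if i = j then X $ i $ j else 0)"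

definition outer :: "real^'n \<Rightarrow> real^'n^'n" where
  "outer x = (\<chi> i j. x $ i * x $ j)"

definition corank :: "real^'n^'n \<Rightarrow> nat" where
  "corank X = CARD('n) - rank X"

definition supp :: "real^'n \<Rightarrow> 'n set" where
  "supp x = {i. x $ i \<noteq> 0}"

definition l0norm :: "real^'n \<Rightarrow> nat" where
  "l0norm x = card (supp x)"

definition S_set :: "nat \<Rightarrow> (real^'n^'n) set" where
  "S_set k = {X \<in> sym_mats. real k *\<^sub>R diag_part X \<succeq> X \<and> X \<succeq> 0}"

definition Q_set :: "nat \<Rightarrow> (real^'n^'n) set" where
  "Q_set k = {outer x | x. l0norm x \<le> k}"

section \<open>The three optimization problems\<close>

text \<open>The constraint data are \<open>A :: 'm \<Rightarrow> real^'n^'n\<close> and \<open>b :: real^'m\<close>, with the finite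
  type \<open>'m\<close> playing the role of \<open>[m]\<close>.\<close>

definition P_feasible :: "('m::finite \<Rightarrow> real^'n^'n) \<Rightarrow> real^'m \<Rightarrow> nat \<Rightarrow> real^'n \<Rightarrow> bool" where
  "P_feasible A b k x \<longleftrightarrow> l0norm x \<le> k \<and> (\<forall>i. x \<bullet> (A i *v x) = b $ i)"

definition P_obj :: "real^'n^'n \<Rightarrow> real^'n \<Rightarrow> real" where
  "P_obj C x = x \<bullet> (C *v x)"

definition Q_feasible :: "('m::finite \<Rightarrow> real^'n^'n) \<Rightarrow> real^'m \<Rightarrow> nat \<Rightarrow> real^'n^'n \<Rightarrow> bool" where
  "Q_feasible A b k X \<longleftrightarrow> X \<in> sym_mats \<and> (\<forall>i. A i \<bullet>\<^sub>F X = b $ i) \<and> X \<in> S_set k"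

definition Q_obj :: "real^'n^'n \<Rightarrow> real^'n^'n \<Rightarrow> real" where
  "Q_obj C X = C \<bullet>\<^sub>F X"

definition D_feasible ::
  "real^'n^'n \<Rightarrow> ('m::finite \<Rightarrow> real^'n^'n) \<Rightarrow> nat \<Rightarrow> (real^'m) \<times> (real^'n^'n) \<Rightarrow> bool" where
  "D_feasible C A k = (\<lambda>(l, Z). Z \<in> sym_mats \<and>
     C - (\<Sum>i\<in>UNIV. l $ i *\<^sub>R A i) - (real k *\<^sub>R diag_part Z - Z) \<succeq> 0 \<and> Z \<succeq> 0)"

definition D_obj :: "real^'m \<Rightarrow> (real^'m) \<times> (real^'n^'n) \<Rightarrow> real" where
  "D_obj b = (\<lambda>(l, Z). \<Sum>i\<in>UNIV. l $ i * b $ i)"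

text \<open>Optimal values are extended reals: an infeasible minimization has value \<open>\<infinity>\<close> and an
  unbounded one \<open>-\<infinity>\<close> (dually for the maximization problem).\<close>

definition val_P :: "real^'n^'n \<Rightarrow> ('m::finite \<Rightarrow> real^'n^'n) \<Rightarrow> real^'m \<Rightarrow> nat \<Rightarrow> ereal" where
  "val_P C A b k = (INF x\<in>{x. P_feasible A b k x}. ereal (P_obj C x))"

definition val_Q :: "real^'n^'n \<Rightarrow> ('m::finite \<Rightarrow> real^'n^'n) \<Rightarrow> real^'m \<Rightarrow> nat \<Rightarrow> ereal" where
  "val_Q C A b k = (INF X\<in>{X. Q_feasible A b k X}. ereal (Q_obj C X))"

definition val_D :: "real^'n^'n \<Rightarrow> ('m::finite \<Rightarrow> real^'n^'n) \<Rightarrow> real^'m \<Rightarrow> nat \<Rightarrow> ereal" where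
  "val_D C A b k = (SUP p\<in>{p. D_feasible C A k p}. ereal (D_obj b p))"

definition optimal_P ::
  "real^'n^'n \<Rightarrow> ('m::finite \<Rightarrow> real^'n^'n) \<Rightarrow> real^'m \<Rightarrow> nat \<Rightarrow> real^'n \<Rightarrow> bool" where
  "optimal_P C A b k = is_arg_min (P_obj C) (P_feasible A b k)"

definition optimal_Q ::
  "real^'n^'n \<Rightarrow> ('m::finite \<Rightarrow> real^'n^'n) \<Rightarrow> real^'m \<Rightarrow> nat \<Rightarrow> real^'n^'n \<Rightarrow> bool" where
  "optimal_Q C A b k = is_arg_min (Q_obj C) (Q_feasible A b k)"

definition optimal_D ::
  "real^'n^'n \<Rightarrow> ('m::finite \<Rightarrow> real^'n^'n) \<Rightarrow> real^'m \<Rightarrow> nat \<Rightarrow> (real^'m) \<times> (real^'n^'n) \<Rightarrow> bool" where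
  "optimal_D C A b k = is_arg_max (D_obj b) (D_feasible C A k)"

text \<open>The equality of values is automatic when (Q) attains its minimum; stating it separately
  keeps the definition meaningful for objectives with no optimal solution. Attainment is not
  part of exactness: if \<open>b = 0\<close>, objectives arbitrarily near the given one can be unbounded below.\<close>

definition exact ::
  "real^'n^'n \<Rightarrow> ('m::finite \<Rightarrow> real^'n^'n) \<Rightarrow> real^'m \<Rightarrow> nat \<Rightarrow> bool" where
  "exact C A b k \<longleftrightarrow>
     (\<forall>X. optimal_Q C A b k X \<longrightarrow> X \<in> Q_set k) \<and> val_Q C A b k = val_P C A b k"

definition locally_stable ::
  "real^'n^'n \<Rightarrow> ('m::finite \<Rightarrow> real^'n^'n) \<Rightarrow> real^'m \<Rightarrow> nat \<Rightarrow> bool" where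
  "locally_stable C0 A b k \<longleftrightarrow>
     (\<exists>N. openin (top_of_set sym_mats) N \<and> C0 \<in> N \<and> (\<forall>C\<in>N. exact C A b k))"

section \<open>Smooth manifolds and the Abadie constraint qualification\<close>

text \<open>Differentiability classes on a relatively open subset \<open>U\<close> of a linear subspace \<open>E\<close>.
  The derivative within \<open>U\<close> is determined only on \<open>E\<close>, so only its values at vectors of \<open>E\<close> are
  constrained; as \<open>E\<close> is finite-dimensional, these being \<open>C\<^sup>r\<close> for every fixed vector is
  the same as the derivative, as an operator-valued map on \<open>U\<close>, being \<open>C\<^sup>r\<close>.\<close>

primrec C_k_on ::
  "nat \<Rightarrow> 'a::euclidean_space set \<Rightarrow> 'a set \<Rightarrow> ('a \<Rightarrow> 'b::euclidean_space) \<Rightarrow> bool" where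
  "C_k_on 0 E U f \<longleftrightarrow> continuous_on U f"
| "C_k_on (Suc r) E U f \<longleftrightarrow>
     (\<exists>f'. (\<forall>x\<in>U. (f has_derivative f' x) (at x within U)) \<and>
           (\<forall>v\<in>E. C_k_on r E U (\<lambda>x. f' x v)))"

definition smooth_on ::
  "'a::euclidean_space set \<Rightarrow> 'a set \<Rightarrow> ('a \<Rightarrow> 'b::euclidean_space) \<Rightarrow> bool" where
  "smooth_on E U f \<longleftrightarrow> (\<forall>r. C_k_on r E U f)"

text \<open>Near its point \<open>x\<close>, the set \<open>M\<close> is a smooth embedded submanifold of codimension \<open>c\<close> in the
  linear space \<open>E\<close>: some smooth chart of \<open>E\<close> around \<open>x\<close> flattens \<open>M\<close> to a subspace of
  codimension \<open>c\<close>.\<close>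

definition smooth_manifold_near ::
  "'a::euclidean_space set \<Rightarrow> 'a set \<Rightarrow> 'a \<Rightarrow> nat \<Rightarrow> bool" where
  "smooth_manifold_near E M x c \<longleftrightarrow> x \<in> M \<and> M \<subseteq> E \<and>
     (\<exists>U V \<phi> \<psi> L.
        openin (top_of_set E) U \<and> x \<in> U \<and> openin (top_of_set E) V \<and>
        homeomorphism U V \<phi> \<psi> \<and> smooth_on E U \<phi> \<and> smooth_on E V \<psi> \<and>
        subspace L \<and> L \<subseteq> E \<and> dim L + c = dim E \<and>
        \<phi> ` (M \<inter> U) = L \<inter> V)"

text \<open>The space \<open>\<real>\<^sup>S\<close> of vectors indexed by \<open>S\<close>, as the coordinate subspace of \<open>real^'n\<close>.\<close>

definition coord_subspace :: "'n set \<Rightarrow> (real^'n) set" where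
  "coord_subspace S = {x. \<forall>i. i \<notin> S \<longrightarrow> x $ i = 0}"

definition g_map :: "('m::finite \<Rightarrow> real^'n^'n) \<Rightarrow> real^'m \<Rightarrow> real^'n \<Rightarrow> real^'m" where
  "g_map A b x = (\<chi> i. x \<bullet> (A i *v x) - b $ i)"

definition X_set :: "('m::finite \<Rightarrow> real^'n^'n) \<Rightarrow> real^'m \<Rightarrow> 'n set \<Rightarrow> (real^'n) set" where
  "X_set A b S = {x. g_map A b x = 0 \<and> (\<forall>i. i \<notin> S \<longrightarrow> x $ i = 0)}"

text \<open>The map \<open>g\<^sub>S\<close> is represented on all of \<open>real^'n\<close>, ignoring the coordinates outside \<open>S\<close>.
  Its Jacobian is that of \<open>g\<^sub>S : \<real>\<^sup>S \<rightarrow> \<real>\<^sup>m\<close> padded with zero columns, so it has the same rank.\<close>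

definition g_restrict ::
  "('m::finite \<Rightarrow> real^'n^'n) \<Rightarrow> real^'m \<Rightarrow> 'n set \<Rightarrow> real^'n \<Rightarrow> real^'m" where
  "g_restrict A b S x = g_map A b (\<chi> i. if i \<in> S then x $ i else 0)"

definition ACQ ::
  "('m::finite \<Rightarrow> real^'n^'n) \<Rightarrow> real^'m \<Rightarrow> 'n set \<Rightarrow> real^'n \<Rightarrow> bool" where
  "ACQ A b S x \<longleftrightarrow>
     (\<exists>c. smooth_manifold_near (coord_subspace S) (X_set A b S) x c \<and>
          rank (jacobian (g_restrict A b S) (at x)) = c)"

end

theory Submission
  imports Defs
begin

text \<open>For \<open>C\<close> close to the given objective, let \<open>x\<close> minimize \<open>x\<^sup>T C x\<close> over the points of
  \<open>X\<^sub>S\<close> near \<open>x0\<close>. As the slack matrix at \<open>C0\<close> is positive semidefinite with kernel spanned by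
  \<open>x0\<close>, this \<open>x\<close> converges to \<open>x0\<close>, and ACQ yields multipliers \<open>\<lambda>\<close> converging to \<open>l0\<close> for which
  \<open>(C - \<Sum> \<lambda>\<^sub>i A\<^sub>i) x\<close> vanishes on \<open>S\<close>. A small positive semidefinite \<open>Z\<close>, complementary to \<open>x x\<^sup>T\<close>,
  cancels the remaining entries. The resulting slack matrix annihilates \<open>x\<close> and is close to one that
  is positive definite on the orthogonal complement of \<open>x0\<close>, so it is positive semidefinite of
  corank one: a dual certificate showing that every optimal solution is a multiple of \<open>x x\<^sup>T\<close>.\<close>

section \<open>Positive semidefinite matrices\<close>

text \<open>The entries outside \<open>S\<close> can be cancelled because the support is full. By
  Cauchy-Schwarz, if \<open>S\<close> has \<open>k\<close> elements, the form of
  \<open>k *\<^sub>R diag_part (outer x) - outer x\<close> vanishes at \<open>v\<close> exactly when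
  the products \<open>x $ i * v $ i\<close> agree on \<open>S\<close>. With fewer elements it would
  vanish only at \<open>v\<close> that are zero on \<open>S\<close>, and a complementary
  \<open>Z\<close> would then act on \<open>x\<close> as zero. So \<open>Z\<close> may combine the
  entrywise inverse of \<open>x\<close> with arbitrary entries off \<open>S\<close>. The case
  \<open>b = 0\<close> has two obstacles of its own: \<open>x0\<close> is minimal only up to
  scaling, and nearby objectives may be unbounded below. A multiple \<open>m\<close> of the identity
  is therefore subtracted from the objective, and its sign decides between a certificate
  (\<open>m \<ge> 0\<close>) and unboundedness (\<open>m < 0\<close>). Neighborhoods are replaced by
  sequences \<open>C n\<close> tending to \<open>C0\<close>, so that limits take the place of
  explicit radii.\<close>

lemma frob_eq_inner: "A \<bullet>\<^sub>F B = A \<bullet> (B :: real^'n^'n)"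
proof -
  have "A \<bullet>\<^sub>F B = (\<Sum>i\<in>UNIV. \<Sum>j\<in>UNIV. A $ j $ i * B $ j $ i)"
    by (simp add: frob_def trace_def matrix_matrix_mult_def transpose_def mult.commute)
  also have "\<dots> = (\<Sum>j\<in>UNIV. \<Sum>i\<in>UNIV. A $ j $ i * B $ j $ i)"
    by (rule sum.swap)
  finally show ?thesis by (simp add: inner_vec_def)
qed

lemma inner_outer: "A \<bullet> outer v = v \<bullet> (A *v v)"
  by (simp add: inner_vec_def outer_def matrix_vector_mult_def sum_distrib_left mult_ac)

lemma outer_mult: "outer u *v v = (u \<bullet> v) *\<^sub>R u"
  by (simp add: vec_eq_iff outer_def matrix_vector_mult_def inner_vec_def sum_distrib_left mult_ac)

lemma outer_scaleR: "outer (a *\<^sub>R v) = a\<^sup>2 *\<^sub>R outer v"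
  by (simp add: vec_eq_iff outer_def power2_eq_square mult_ac)

lemma outer_zero [simp]: "outer 0 = 0"
  by (simp add: vec_eq_iff outer_def)

lemma norm_outer: "norm (outer v) = (norm v)\<^sup>2"
  by (simp add: norm_eq_sqrt_inner inner_outer outer_mult)

lemma abs_quadratic_form_le: "\<bar>v \<bullet> (A *v v)\<bar> \<le> norm A * (norm v)\<^sup>2"
  for v :: "real^'n"
  using Cauchy_Schwarz_ineq2[of A "outer v"] by (simp add: inner_outer norm_outer)

lemma sym_mats_iff: "X \<in> sym_mats \<longleftrightarrow> (\<forall>i j. X $ i $ j = X $ j $ i)"
  by (auto simp: sym_mats_def transpose_def vec_eq_iff)

lemma subspace_sym_mats: "subspace sym_mats"
  by (auto simp: subspace_def sym_mats_iff)

lemmas sym_mats_intros =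
  subspace_add[OF subspace_sym_mats] subspace_diff[OF subspace_sym_mats]
  subspace_scale[OF subspace_sym_mats] subspace_sum[OF subspace_sym_mats]
  subspace_0[OF subspace_sym_mats]

lemma outer_sym: "outer v \<in> sym_mats"
  by (simp add: sym_mats_iff outer_def mult.commute)

lemma diag_part_sym: "diag_part X \<in> sym_mats"
  by (auto simp: sym_mats_iff diag_part_def)

lemma mat_sym: "mat a \<in> sym_mats"
  by (auto simp: sym_mats_iff mat_def)

lemma sym_inner_swap:
  assumes "X \<in> sym_mats" shows "u \<bullet> (X *v v) = v \<bullet> (X *v u)"
proof -
  have "u \<bullet> (X *v v) = (X *v u) \<bullet> v"
    using assms dot_lmul_matrix[of u X v] vector_transpose_matrix[of u X]
    by (simp add: sym_mats_def)
  then show ?thesis by (simp add: inner_commute)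
qed

lemma quadratic_form_add:
  assumes "X \<in> sym_mats"
  shows "(u + w) \<bullet> (X *v (u + w)) = u \<bullet> (X *v u) + 2 * (u \<bullet> (X *v w)) + w \<bullet> (X *v w)"
  using sym_inner_swap[OF assms, of w u]
  by (simp add: matrix_vector_right_distrib inner_add_left inner_add_right)

lemma quadratic_form_diff_scaleR:
  assumes "X \<in> sym_mats"
  shows "(u - s *\<^sub>R w) \<bullet> (X *v (u - s *\<^sub>R w)) =
    u \<bullet> (X *v u) - 2 * s * (u \<bullet> (X *v w)) + s\<^sup>2 * (w \<bullet> (X *v w))"
  using sym_inner_swap[OF assms, of w u]
  by (simp add: matrix_vector_mult_diff_distrib matrix_vector_mult_scaleR inner_diff_left
      inner_diff_right power2_eq_square algebra_simps)

lemma psd_outer: "psd (outer v)"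
  by (simp add: psd_def outer_sym outer_mult inner_commute)

lemma psd_scaleR: "psd X \<Longrightarrow> 0 \<le> a \<Longrightarrow> psd (a *\<^sub>R X)"
  by (simp add: psd_def sym_mats_intros scaleR_matrix_vector_assoc[symmetric])

lemma psd_null:
  assumes "psd X" and "w \<bullet> (X *v w) = 0"
  shows "X *v w = 0"
proof -
  have sym: "X \<in> sym_mats" and nonneg: "\<And>v. 0 \<le> v \<bullet> (X *v v)"
    using assms by (auto simp: psd_def)
  define u where "u = X *v w"
  define p where "p = u \<bullet> (X *v u)"
  have p: "0 \<le> p" using nonneg by (simp add: p_def)
  \<comment> \<open>The form along \<open>u - t *\<^sub>R w\<close> is affine in \<open>t\<close>,
    as \<open>w\<close> contributes no quadratic term; being nonnegative for every \<open>t\<close>,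
    it must have slope zero.\<close>
  have *: "0 \<le> p - 2 * t * (u \<bullet> u)" for t
    using nonneg[of "u - t *\<^sub>R w"] assms(2)
    by (simp add: quadratic_form_diff_scaleR[OF sym] p_def u_def)
  have "u \<bullet> u = 0"
  proof (rule ccontr)
    assume "u \<bullet> u \<noteq> 0"
    then have "0 \<le> p - 2 * (p + 1)" using *[of "(p + 1) / (u \<bullet> u)"] by simp
    then show False using p by simp
  qed
  then show ?thesis by (simp add: u_def)
qed

lemma matrix_vector_axis_component: "(X *v axis i 1) $ j = X $ j $ i" for X :: "real^'n^'m"
  by (simp add: matrix_vector_mult_basis column_def)

lemma quadratic_form_axis: "axis i 1 \<bullet> (X *v axis i 1) = X $ i $ i" for X :: "real^'n^'n"
  by (simp add: inner_axis' matrix_vector_axis_component)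

lemma psd_diag_null:
  assumes "psd X" "X $ i $ i = 0" shows "X $ j $ i = 0"
  using psd_null[OF assms(1), of "axis i 1"] assms(2)
  by (metis matrix_vector_axis_component quadratic_form_axis zero_index)

text \<open>Gaussian elimination: subtracting the rank-one matrix built from a column with positive
  diagonal entry leaves a positive semidefinite matrix with one more vanishing diagonal entry.\<close>

lemma psd_sum_outer:
  fixes X :: "real^'n^'n"
  assumes "psd X"
  shows "\<exists>vs. X = (\<Sum>v\<leftarrow>vs. outer v)"
  using assms
proof (induction "card {i. X $ i $ i \<noteq> 0}" arbitrary: X rule: less_induct)
  case less
  have sym: "X \<in> sym_mats" and nonneg: "\<And>v. 0 \<le> v \<bullet> (X *v v)"
    using less.prems by (auto simp: psd_def)
  show ?case
  proof (cases "\<exists>i. X $ i $ i \<noteq> 0")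
    case False
    then have "X = 0"
      using psd_diag_null[OF less.prems] by (auto simp: vec_eq_iff)
    then show ?thesis by (intro exI[of _ "[]"]) simp
  next
    case True
    then obtain i where i: "X $ i $ i \<noteq> 0" by blast
    then have pos: "X $ i $ i > 0"
      using nonneg[of "axis i 1"] by (simp add: quadratic_form_axis)
    define d where "d = X $ i $ i"
    define c where "c = X *v axis i 1"
    define v where "v = (1 / sqrt d) *\<^sub>R c"
    have ov: "outer v = (1 / d) *\<^sub>R outer c"
      using pos by (simp add: v_def outer_scaleR d_def power_divide)
    have d: "d > 0" using pos by (simp add: d_def)
    define X' where "X' = X - outer v"
    have "psd X'"
      unfolding psd_def
    proof (intro conjI allI)
      show "X' \<in> sym_mats" unfolding X'_def by (intro sym_mats_intros sym outer_sym)
      fix u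
      \<comment> \<open>This \<open>s\<close> minimizes the form along
        \<open>u - s *\<^sub>R axis i 1\<close>; the minimum is the form of the Schur complement
        \<open>X'\<close> at \<open>u\<close>.\<close>
      define s where "s = (u \<bullet> c) / d"
      have sd: "s * d = u \<bullet> c" using d by (simp add: s_def)
      have "0 \<le> (u - s *\<^sub>R axis i 1) \<bullet> (X *v (u - s *\<^sub>R axis i 1))"
        by (rule nonneg)
      also have "\<dots> = u \<bullet> (X *v u) - 2 * s * (u \<bullet> c) + s * (s * d)"
        by (subst quadratic_form_diff_scaleR[OF sym])
           (simp add: quadratic_form_axis d_def c_def power2_eq_square)
      also have "\<dots> = u \<bullet> (X *v u) - s * (u \<bullet> c)"
        by (simp add: sd)
      also have "\<dots> = u \<bullet> (X' *v u)"
        by (simp add: X'_def ov matrix_vector_mult_diff_rdistrib inner_diff_right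
            scaleR_matrix_vector_assoc[symmetric] outer_mult s_def inner_commute)
      finally show "0 \<le> u \<bullet> (X' *v u)" .
    qed
    moreover have "{j. X' $ j $ j \<noteq> 0} \<subset> {j. X $ j $ j \<noteq> 0}"
    proof -
      have comp: "X' $ j $ j = X $ j $ j - (c $ j)\<^sup>2 / d" for j
        unfolding X'_def ov by (simp add: outer_def power2_eq_square)
      have "c $ j = 0" if "X $ j $ j = 0" for j
        using psd_diag_null[OF less.prems that, of i] sym
        by (simp add: c_def matrix_vector_axis_component sym_mats_iff)
      then have "{j. X' $ j $ j \<noteq> 0} \<subseteq> {j. X $ j $ j \<noteq> 0}"
        by (auto simp: comp)
      moreover have "X' $ i $ i = 0"
        using d by (simp add: comp c_def matrix_vector_axis_component d_def power2_eq_square)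
      ultimately show ?thesis using i by blast
    qed
    then have "card {j. X' $ j $ j \<noteq> 0} < card {j. X $ j $ j \<noteq> 0}"
      by (simp add: psubset_card_mono)
    ultimately obtain vs where "X' = (\<Sum>v\<leftarrow>vs. outer v)"
      using less.hyps by blast
    then have "X = (\<Sum>v\<leftarrow>v # vs. outer v)" by (simp add: X'_def algebra_simps)
    then show ?thesis by blast
  qed
qed

lemma inner_sum_list_outer: "Q \<bullet> (\<Sum>v\<leftarrow>vs. outer v) = (\<Sum>v\<leftarrow>vs. v \<bullet> (Q *v v))"
  by (induction vs) (simp_all add: inner_add_right inner_outer)

lemma psd_inner_nonneg:
  assumes "psd Q" "psd X" shows "0 \<le> Q \<bullet> X"
proof -
  obtain vs where "X = (\<Sum>v\<leftarrow>vs. outer v)" using psd_sum_outer[OF assms(2)] by blast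
  then have "Q \<bullet> X = (\<Sum>v\<leftarrow>vs. v \<bullet> (Q *v v))" by (simp add: inner_sum_list_outer)
  also have "\<dots> \<ge> 0" using assms(1) by (intro sum_list_nonneg) (auto simp: psd_def)
  finally show ?thesis .
qed

text \<open>Once \<open>X\<close> is a sum of matrices \<open>outer v\<close>, the product with
  \<open>Q\<close> is a sum of nonnegative terms, so each \<open>v\<close> lies on the line of
  \<open>x\<close> and the sum collapses to one rank-one matrix. This is how corank one of the slack
  yields rank one of optimal solutions.\<close>

lemma psd_inner_zero_imp_outer:
  assumes "psd Q" and ker: "\<And>v. v \<bullet> (Q *v v) = 0 \<Longrightarrow> \<exists>a. v = a *\<^sub>R x"
    and "psd X" "Q \<bullet> X \<le> 0"
  shows "\<exists>a. X = outer (a *\<^sub>R x)"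
proof -
  obtain vs where vs: "X = (\<Sum>v\<leftarrow>vs. outer v)" using psd_sum_outer[OF assms(3)] by blast
  have nn: "\<And>v. 0 \<le> v \<bullet> (Q *v v)" using assms(1) by (auto simp: psd_def)
  have "(\<Sum>v\<leftarrow>vs. v \<bullet> (Q *v v)) = 0"
    using assms(4) psd_inner_nonneg[OF assms(1,3)] by (simp add: vs inner_sum_list_outer)
  then have "\<forall>v\<in>set vs. v \<bullet> (Q *v v) = 0"
    using nn by (subst (asm) sum_list_nonneg_eq_0_iff) auto
  then have "\<forall>v\<in>set vs. \<exists>a. v = a *\<^sub>R x" using ker by blast
  then have "\<exists>s\<ge>0. (\<Sum>v\<leftarrow>vs. outer v) = s *\<^sub>R outer x"
  proof (induction vs)
    case Nil
    show ?case by (intro exI[of _ 0]) simp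
  next
    case (Cons v vs)
    then obtain s a where "0 \<le> s" "(\<Sum>v\<leftarrow>vs. outer v) = s *\<^sub>R outer x" "v = a *\<^sub>R x"
      by auto
    then show ?case
      by (intro exI[of _ "a\<^sup>2 + s"]) (simp add: outer_scaleR scaleR_left_distrib)
  qed
  then obtain s where "0 \<le> s" "X = s *\<^sub>R outer x" using vs by blast
  then have "X = outer (sqrt s *\<^sub>R x)" by (simp add: outer_scaleR)
  then show ?thesis by blast
qed

section \<open>Perturbing a semidefinite matrix while keeping a kernel vector\<close>

lemma tendsto_matrix_vector_mult [tendsto_intros]:
  fixes M :: "'a \<Rightarrow> real^'n^'m"
  assumes "(M \<longlongrightarrow> N) F" "(x \<longlongrightarrow> y) F"
  shows "((\<lambda>n. M n *v x n) \<longlongrightarrow> N *v y) F"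
  unfolding matrix_vector_mult_def by (intro tendsto_intros assms)

lemma continuous_on_quadratic_form [continuous_intros]:
  fixes M :: "real^'n^'n"
  shows "continuous_on U (\<lambda>x. x \<bullet> (M *v x))"
  by (intro continuous_intros linear_continuous_on) simp

text \<open>A vector orthogonal to \<open>x\<close> on which the form vanishes is also a multiple of
  \<open>x\<close>, hence zero; compactness of the unit sphere in the hyperplane turns positivity
  into a uniform bound.\<close>

lemma psd_coercive:
  assumes "psd Q" and ker: "\<And>v. Q *v v = 0 \<Longrightarrow> \<exists>a. v = a *\<^sub>R x"
  shows "\<exists>s>0. \<forall>w. x \<bullet> w = 0 \<longrightarrow> s * (norm w)\<^sup>2 \<le> w \<bullet> (Q *v w)"
proof -
  define K where "K = sphere 0 1 \<inter> {w. x \<bullet> w = 0}"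
  have "compact K" unfolding K_def
    by (intro compact_Int_closed) (auto simp: closed_hyperplane)
  have pos: "0 < w \<bullet> (Q *v w)" if "x \<bullet> w = 0" "w \<noteq> 0" for w
  proof -
    have "w \<bullet> (Q *v w) \<noteq> 0"
    proof
      assume "w \<bullet> (Q *v w) = 0"
      then obtain a where "w = a *\<^sub>R x" using ker psd_null[OF assms(1)] by blast
      then have "w \<bullet> w = 0" using that(1) by simp
      then show False using that(2) by simp
    qed
    moreover have "0 \<le> w \<bullet> (Q *v w)" using assms(1) by (auto simp: psd_def)
    ultimately show ?thesis by linarith
  qed
  have "\<exists>s>0. \<forall>w\<in>K. s \<le> w \<bullet> (Q *v w)"
  proof (cases "K = {}")
    case True
    then show ?thesis by (intro exI[of _ 1]) auto
  next
    case False
    obtain w0 where "w0 \<in> K" "\<forall>w\<in>K. w0 \<bullet> (Q *v w0) \<le> w \<bullet> (Q *v w)"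
      using continuous_attains_inf[OF \<open>compact K\<close> False continuous_on_quadratic_form] by blast
    moreover from this have "0 < w0 \<bullet> (Q *v w0)" by (intro pos) (auto simp: K_def)
    ultimately show ?thesis by blast
  qed
  then obtain s where s: "s > 0" "\<And>w. w \<in> K \<Longrightarrow> s \<le> w \<bullet> (Q *v w)" by blast
  have "s * (norm w)\<^sup>2 \<le> w \<bullet> (Q *v w)" if "x \<bullet> w = 0" for w
  proof (cases "w = 0")
    case False
    have "s \<le> ((1 / norm w) *\<^sub>R w) \<bullet> (Q *v ((1 / norm w) *\<^sub>R w))"
      using that False by (intro s) (simp add: K_def)
    also have "\<dots> = (w \<bullet> (Q *v w)) / (norm w)\<^sup>2"
      by (simp add: matrix_vector_mult_scaleR power2_eq_square)
    finally show ?thesis using False by (simp add: field_simps)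
  qed simp
  then show ?thesis using s(1) by blast
qed

text \<open>Convergence alone would not prevent a small negative eigenvalue. The kernel vector
  \<open>x n\<close> does: it takes up the only direction in which \<open>Q0\<close> is not
  coercive, and on the fixed hyperplane orthogonal to \<open>x0\<close> the constant
  \<open>s\<close> survives any perturbation of norm below \<open>s\<close>.\<close>

lemma eventually_psd:
  fixes Q :: "'a \<Rightarrow> real^'n^'n"
  assumes "psd Q0" and ker: "\<And>v. Q0 *v v = 0 \<Longrightarrow> \<exists>a. v = a *\<^sub>R x0" and "x0 \<noteq> 0"
    and Q: "(Q \<longlongrightarrow> Q0) F" and x: "(x \<longlongrightarrow> x0) F"
    and sym: "\<forall>\<^sub>F n in F. Q n \<in> sym_mats \<and> Q n *v x n = 0"
  shows "\<forall>\<^sub>F n in F. psd (Q n) \<and> (\<forall>v. v \<bullet> (Q n *v v) = 0 \<longrightarrow> (\<exists>a. v = a *\<^sub>R x n))"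
proof -
  obtain s where s: "s > 0" "\<And>w. x0 \<bullet> w = 0 \<Longrightarrow> s * (norm w)\<^sup>2 \<le> w \<bullet> (Q0 *v w)"
    using psd_coercive[OF assms(1) ker] by blast
  have e1: "\<forall>\<^sub>F n in F. norm (Q n - Q0) < s"
    using tendstoD[OF Q s(1)] by (simp add: dist_norm)
  have "((\<lambda>n. x0 \<bullet> x n) \<longlongrightarrow> x0 \<bullet> x0) F" by (intro tendsto_intros x)
  then have e2: "\<forall>\<^sub>F n in F. x0 \<bullet> x n > 0"
    using \<open>x0 \<noteq> 0\<close> by (intro order_tendstoD) auto
  show ?thesis using e1 e2 sym
  proof eventually_elim
    case (elim n)
    have form: "\<exists>a w. v = w + a *\<^sub>R x n \<and> v \<bullet> (Q n *v v) = w \<bullet> (Q n *v w)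
        \<and> 0 \<le> w \<bullet> (Q n *v w) \<and> (w \<bullet> (Q n *v w) = 0 \<longrightarrow> w = 0)" for v
    proof -
      \<comment> \<open>Projection along \<open>x n\<close>, not along \<open>x0\<close>, so that
        \<open>w\<close> lies in the hyperplane where \<open>s\<close> applies while the removed
        part stays in the kernel of \<open>Q n\<close>.\<close>
      define a where "a = (x0 \<bullet> v) / (x0 \<bullet> x n)"
      define w where "w = v - a *\<^sub>R x n"
      have v: "v = w + a *\<^sub>R x n" by (simp add: w_def)
      have "x0 \<bullet> w = 0" using elim by (simp add: w_def a_def inner_diff_right)
      then have 1: "s * (norm w)\<^sup>2 \<le> w \<bullet> (Q0 *v w)" by (rule s)
      have 2: "v \<bullet> (Q n *v v) = w \<bullet> (Q n *v w)"
        using elim unfolding v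
        by (subst quadratic_form_add) (auto simp: matrix_vector_mult_scaleR)
      have 3: "w \<bullet> (Q n *v w) = w \<bullet> (Q0 *v w) + w \<bullet> ((Q n - Q0) *v w)"
        by (simp add: matrix_vector_mult_diff_rdistrib inner_diff_right)
      have 4: "(s - norm (Q n - Q0)) * (norm w)\<^sup>2 \<le> w \<bullet> (Q n *v w)"
        using 1 3 abs_quadratic_form_le[of w "Q n - Q0"] by (simp add: algebra_simps)
      have "0 \<le> (s - norm (Q n - Q0)) * (norm w)\<^sup>2" using elim by simp
      moreover have "w = 0" if "w \<bullet> (Q n *v w) = 0"
      proof (rule ccontr)
        assume "w \<noteq> 0"
        then have "0 < (s - norm (Q n - Q0)) * (norm w)\<^sup>2" using elim by simp
        then show False using 4 that by linarith
      qed
      ultimately show ?thesis using v 2 4 by (intro exI[of _ a] exI[of _ w]) linarith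
    qed
    show ?case
      unfolding psd_def using elim form by (metis add_0)
  qed
qed

section \<open>Duality and exactness\<close>

lemma sum_diagonal:
  "(\<Sum>j\<in>UNIV. (if i = j then f j else 0) * g j) = f i * g i" for f g :: "'n::finite \<Rightarrow> real"
proof -
  have "(\<Sum>j\<in>UNIV. (if i = j then f j else 0) * g j) = (\<Sum>j\<in>UNIV. if i = j then f j * g j else 0)"
    by (intro sum.cong) auto
  then show ?thesis by simp
qed

lemma inner_diag_part: "diag_part Z \<bullet> X = Z \<bullet> diag_part X"
  by (simp add: inner_vec_def diag_part_def sum_diagonal mult.commute[of "Z $ _ $ _"])

lemma diag_part_mult: "(diag_part Z *v x) $ i = Z $ i $ i * x $ i"
  by (simp add: matrix_vector_mult_def diag_part_def sum_diagonal)

lemma linear_diag_part: "linear diag_part"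
  by (rule linearI) (auto simp: diag_part_def vec_eq_iff)

text \<open>Cauchy-Schwarz on the support, against the vector of ones; equality holds when
  \<open>x $ i * v $ i\<close> is constant there.\<close>

lemma inner_diag_outer_le:
  "(x \<bullet> v)\<^sup>2 \<le> real (l0norm x) * (v \<bullet> (diag_part (outer x) *v v))"
proof -
  have "x \<bullet> v = (\<Sum>i\<in>supp x. x $ i * v $ i)"
    unfolding inner_vec_def by (rule sum.mono_neutral_cong_right) (auto simp: supp_def)
  then have "(x \<bullet> v)\<^sup>2 \<le> (\<Sum>i\<in>supp x. (x $ i * v $ i)\<^sup>2) * card (supp x)"
    using sum_squared_le_sum_of_squares[of "\<lambda>i. x $ i * v $ i" "supp x"] by simp
  also have "(\<Sum>i\<in>supp x. (x $ i * v $ i)\<^sup>2) = v \<bullet> (diag_part (outer x) *v v)"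
    unfolding inner_vec_def diag_part_mult
    by (rule sum.mono_neutral_cong_left)
       (auto simp: supp_def outer_def power2_eq_square)
  finally show ?thesis by (simp add: l0norm_def mult.commute)
qed

lemma psd_diag_outer:
  assumes "l0norm x \<le> k"
  shows "psd (real k *\<^sub>R diag_part (outer x) - outer x)"
  unfolding psd_def
proof (intro conjI allI)
  show "real k *\<^sub>R diag_part (outer x) - outer x \<in> sym_mats"
    by (intro sym_mats_intros diag_part_sym outer_sym)
  fix v
  have nn: "0 \<le> v \<bullet> (diag_part (outer x) *v v)"
    unfolding inner_vec_def diag_part_mult
    by (intro sum_nonneg) (simp add: outer_def mult.left_commute[of "v $ i" for i])
  have "(x \<bullet> v)\<^sup>2 \<le> real (l0norm x) * (v \<bullet> (diag_part (outer x) *v v))"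
    by (rule inner_diag_outer_le)
  also have "\<dots> \<le> real k * (v \<bullet> (diag_part (outer x) *v v))"
    using assms nn by (intro mult_right_mono) auto
  finally show "0 \<le> v \<bullet> ((real k *\<^sub>R diag_part (outer x) - outer x) *v v)"
    by (simp add: matrix_vector_mult_diff_rdistrib scaleR_matrix_vector_assoc[symmetric]
        inner_diff_right outer_mult inner_commute power2_eq_square)
qed

lemma Q_feasible_outer:
  assumes "P_feasible A b k x" shows "Q_feasible A b k (outer x)"
  using assms psd_diag_outer[of x k] psd_outer[of x] outer_sym[of x]
  by (auto simp: P_feasible_def Q_feasible_def S_set_def psd_ge_def frob_eq_inner inner_outer)

lemma Q_obj_outer: "Q_obj C (outer x) = P_obj C x"
  by (simp add: Q_obj_def P_obj_def frob_eq_inner inner_outer)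

lemma val_Q_le_val_P: "val_Q C A b k \<le> val_P C A b k"
  unfolding val_Q_def val_P_def
  by (intro INF_mono) (auto simp: Q_obj_outer intro!: exI[of _ "outer _"] Q_feasible_outer)

lemma Q_feasible_psd:
  assumes "Q_feasible A b k X"
  shows "psd X" "psd (real k *\<^sub>R diag_part X - X)" "A i \<bullet> X = b $ i"
  using assms by (auto simp: Q_feasible_def S_set_def psd_ge_def frob_eq_inner)

text \<open>Weak duality in which the gap is at least the product of \<open>Q\<close> with
  \<open>X\<close>. The kernel direction \<open>x\<close> and the point \<open>y\<close> attaining
  the bound are kept apart: for \<open>b = 0\<close> the latter may be \<open>0\<close>, while
  \<open>x\<close> still has to span the kernel.\<close>

lemma exact_if_certificate:
  assumes "psd Q" and ker: "\<And>v. v \<bullet> (Q *v v) = 0 \<Longrightarrow> \<exists>a. v = a *\<^sub>R x"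
    and "l0norm x \<le> k" and y: "P_feasible A b k y"
    and bound: "\<And>X. Q_feasible A b k X \<Longrightarrow> P_obj C y + Q \<bullet> X \<le> Q_obj C X"
  shows "exact C A b k"
  unfolding exact_def
proof (intro conjI allI impI antisym)
  fix X assume "optimal_Q C A b k X"
  then have X: "Q_feasible A b k X" and min: "\<not> Q_obj C (outer y) < Q_obj C X"
    using Q_feasible_outer[OF y] by (auto simp: optimal_Q_def is_arg_min_def)
  then have "Q \<bullet> X \<le> 0" using bound[OF X] by (simp add: Q_obj_outer)
  then obtain a where "X = outer (a *\<^sub>R x)"
    using psd_inner_zero_imp_outer[OF assms(1) ker Q_feasible_psd(1)[OF X]] by blast
  moreover have "l0norm (a *\<^sub>R x) \<le> l0norm x"
    unfolding l0norm_def supp_def by (intro card_mono) auto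
  ultimately show "X \<in> Q_set k"
    using assms(3) unfolding Q_set_def by (auto intro!: exI[of _ "a *\<^sub>R x"])
next
  show "val_Q C A b k \<le> val_P C A b k" by (rule val_Q_le_val_P)
  have "val_P C A b k \<le> ereal (P_obj C y)"
    unfolding val_P_def using y by (intro INF_lower) simp
  also have "\<dots> \<le> val_Q C A b k"
    unfolding val_Q_def
  proof (intro INF_greatest)
    fix X assume "X \<in> {X. Q_feasible A b k X}"
    then have X: "Q_feasible A b k X" by simp
    show "ereal (P_obj C y) \<le> ereal (Q_obj C X)"
      using bound[OF X] psd_inner_nonneg[OF assms(1) Q_feasible_psd(1)[OF X]] by simp
  qed
  finally show "val_P C A b k \<le> val_Q C A b k" .
qed

section \<open>Homogeneous constraints and zero sparsity\<close>

lemma P_feasible_scaleR: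
  "P_feasible A 0 k x \<Longrightarrow> P_feasible A 0 k (a *\<^sub>R x)"
  by (cases "a = 0") (auto simp: P_feasible_def l0norm_def supp_def matrix_vector_mult_scaleR)

lemma P_obj_scaleR: "P_obj C (a *\<^sub>R x) = a\<^sup>2 * P_obj C x"
  by (simp add: P_obj_def matrix_vector_mult_scaleR power2_eq_square)

text \<open>Scaling along a ray of negative value sends both optimal values to
  \<open>-\<infinity>\<close>, and the condition on optimal solutions of (Q) holds
  vacuously.\<close>

lemma exact_if_unbounded:
  assumes x: "P_feasible A 0 k x" and neg: "P_obj C x < 0"
  shows "exact C A 0 k"
proof -
  have below: "\<exists>y. P_feasible A 0 k y \<and> P_obj C y < r" for r
  proof -
    define s where "s = sqrt ((\<bar>r\<bar> + 1) / - P_obj C x)"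
    have "s\<^sup>2 = (\<bar>r\<bar> + 1) / - P_obj C x"
      using neg by (simp add: s_def divide_nonneg_neg)
    then have "P_obj C (s *\<^sub>R x) = - (\<bar>r\<bar> + 1)"
      using neg by (simp add: P_obj_scaleR)
    then show ?thesis using P_feasible_scaleR[OF x] by (intro exI[of _ "s *\<^sub>R x"]) auto
  qed
  have "val_P C A 0 k = -\<infinity>"
  proof (rule ereal_bot)
    fix r
    obtain y where "P_feasible A 0 k y" "P_obj C y < r" using below by blast
    then show "val_P C A 0 k \<le> ereal r"
      unfolding val_P_def by (intro INF_lower2[of y]) auto
  qed
  moreover have "\<not> optimal_Q C A 0 k X" for X
    using below[of "Q_obj C X"] Q_feasible_outer[of A 0 k] Q_obj_outer[of C]
    by (auto simp: optimal_Q_def is_arg_min_def) metis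
  ultimately show ?thesis
    using val_Q_le_val_P[of C A 0 k] by (auto simp: exact_def)
qed

text \<open>For \<open>k = 0\<close> both \<open>X\<close> and \<open>- X\<close> are positive
  semidefinite, which leaves only \<open>X = 0\<close>. If that is infeasible too, both values are
  infinite.\<close>

lemma exact_zero: "exact C A b 0"
proof -
  have X0: "X = 0" if X: "Q_feasible A b 0 X" for X
  proof -
    have "psd X" "psd (- X)" using Q_feasible_psd[OF X] by simp_all
    then have "v \<bullet> (X *v v) = 0" for v
      using matrix_vector_mult_diff_rdistrib[of 0 X v] unfolding psd_def
      by (metis add.inverse_inverse antisym diff_0 inner_minus_right matrix_vector_mult_0 neg_0_le_iff_le)
    then have "X *v v = 0" for v using psd_null[OF \<open>psd X\<close>] by blast
    then show ?thesis by (simp add: matrix_eq)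
  qed
  have Z: "P_feasible A b 0 0" if X: "Q_feasible A b 0 X" for X
    using Q_feasible_psd(3)[OF X] X0[OF X] by (auto simp: P_feasible_def l0norm_def supp_def)
  have "val_P C A b 0 \<le> val_Q C A b 0"
    unfolding val_P_def val_Q_def
  proof (rule INF_mono)
    fix X assume "X \<in> {X. Q_feasible A b 0 X}"
    then have "P_feasible A b 0 0" "X = 0" using Z X0 by blast+
    then show "\<exists>x\<in>{x. P_feasible A b 0 x}. ereal (P_obj C x) \<le> ereal (Q_obj C X)"
      by (auto intro!: exI[of _ 0] simp: P_obj_def Q_obj_def frob_eq_inner)
  qed
  moreover have "X \<in> Q_set 0" if "optimal_Q C A b 0 X" for X
  proof -
    have "X = 0" using that X0 by (auto simp: optimal_Q_def is_arg_min_def)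
    then show ?thesis
      by (auto simp: Q_set_def l0norm_def supp_def intro!: exI[of _ 0])
  qed
  ultimately show ?thesis using val_Q_le_val_P[of C A b 0] by (auto simp: exact_def)
qed

text \<open>Complementarity forces the block of \<open>Z\<close> on the support of \<open>x\<close> to be a multiple of
  \<open>y y\<^sup>T\<close>, where \<open>y\<close> is the entrywise inverse of \<open>x\<close>; the off-diagonal block is then read
  off from the residual \<open>p\<close>. (\<open>inverse 0 = 0\<close> makes \<open>y\<close> vanish off the support.)\<close>

lemma support_multiplier:
  fixes x p :: "real^'n"
  defines "y \<equiv> (\<chi> i. inverse (x $ i))"
  assumes "l0norm x > 0" and p: "\<And>i. i \<in> supp x \<Longrightarrow> p $ i = 0"
  shows "\<exists>Z. psd Z \<and> (real (l0norm x) *\<^sub>R diag_part Z - Z) *v x = p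
    \<and> norm Z \<le> norm p * (norm y + 1)\<^sup>2"
proof (cases "p = 0")
  case True
  then show ?thesis
    by (intro exI[of _ 0])
       (auto simp: psd_def sym_mats_intros linear_0[OF linear_diag_part])
next
  case False
  define k where "k = real (l0norm x)"
  have k: "1 \<le> k" using assms(2) by (simp add: k_def)
  \<comment> \<open>Since \<open>y \<bullet> x = k\<close> and \<open>p \<bullet> x = 0\<close>, the
    matrix \<open>Z\<close> below maps \<open>x\<close> to \<open>k *\<^sub>R z\<close> and its
    diagonal part maps \<open>x\<close> to \<open>t *\<^sub>R y\<close>; the factor
    \<open>1 / k\<close> in \<open>z\<close> makes the difference equal to \<open>p\<close>. Any
    \<open>t > 0\<close> would do for this; \<open>norm p\<close> balances the terms
    \<open>t y y\<^sup>T\<close> and \<open>p p\<^sup>T / (t k\<^sup>2)\<close>, so that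
    \<open>Z\<close> is of order \<open>norm p\<close>.\<close>
  define t where "t = norm p"
  have t: "t > 0" using False by (simp add: t_def)
  define z where "z = t *\<^sub>R y - (1 / k) *\<^sub>R p"
  define Z where "Z = (1 / t) *\<^sub>R outer z"
  have px: "p $ i * x $ i = 0" for i
    using p[of i] by (auto simp: supp_def)
  have "y \<bullet> x = (\<Sum>i\<in>supp x. 1)"
    unfolding inner_vec_def by (rule sum.mono_neutral_cong_right) (auto simp: supp_def y_def)
  then have "y \<bullet> x = k" by (simp add: k_def l0norm_def)
  moreover have "p \<bullet> x = 0" by (simp add: inner_vec_def px del: mult_eq_0_iff)
  ultimately have "z \<bullet> x = t * k" by (simp add: z_def inner_diff_left)
  then have Zx: "Z *v x = k *\<^sub>R z"
    using t by (simp add: Z_def scaleR_matrix_vector_assoc[symmetric] outer_mult)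
  have "(diag_part Z *v x) $ i = t * y $ i" for i
  proof (cases "x $ i = 0")
    case True
    then show ?thesis by (simp add: diag_part_mult y_def)
  next
    case nz: False
    then have zi: "z $ i = t / x $ i"
      using p[of i] by (simp add: z_def y_def supp_def divide_inverse)
    show ?thesis
      using nz t by (simp add: diag_part_mult Z_def outer_def y_def zi field_simps)
  qed
  then have "diag_part Z *v x = t *\<^sub>R y" by (simp add: vec_eq_iff)
  then have "(k *\<^sub>R diag_part Z - Z) *v x = k *\<^sub>R (t *\<^sub>R y) - k *\<^sub>R z"
    by (simp add: matrix_vector_mult_diff_rdistrib scaleR_matrix_vector_assoc[symmetric] Zx)
  also have "\<dots> = p" using k by (simp add: z_def algebra_simps)
  finally have 1: "(k *\<^sub>R diag_part Z - Z) *v x = p" .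
  have 2: "psd Z" unfolding Z_def using t by (intro psd_scaleR psd_outer) auto
  have "norm z \<le> t * norm y + (1 / k) * t"
    unfolding z_def using k t norm_triangle_ineq4[of "t *\<^sub>R y" "(1 / k) *\<^sub>R p"]
    by (simp add: t_def)
  also have "\<dots> \<le> t * (norm y + 1)"
    using k t by (simp add: field_simps)
  finally have "(norm z)\<^sup>2 \<le> (t * (norm y + 1))\<^sup>2" by (intro power_mono) auto
  then have "norm Z \<le> (1 / t) * (t * (norm y + 1))\<^sup>2"
    using t by (simp add: Z_def norm_outer divide_right_mono)
  also have "\<dots> = t * (norm y + 1)\<^sup>2" using t by (simp add: power2_eq_square)
  finally show ?thesis using 1 2 unfolding k_def t_def by blast
qed

section \<open>Tangent spaces and Lagrange multipliers\<close>

text \<open>Chart derivatives exist only within a relatively open subset of a subspace; a curve that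
  stays in that subset still has an unrestricted derivative after composition.\<close>

lemma has_vector_derivative_chain_within:
  assumes h: "(h has_vector_derivative w) (at t)" and "open W" "t \<in> W" "h ` W \<subseteq> U"
    and f: "(f has_derivative D) (at (h t) within U)"
  shows "((\<lambda>s. f (h s)) has_vector_derivative D w) (at t)"
proof -
  have "(h has_derivative (\<lambda>s. s *\<^sub>R w)) (at t within W)"
    using h by (auto simp: has_vector_derivative_def intro: has_derivative_at_withinI)
  moreover have "(f has_derivative D) (at (h t) within h ` W)"
    using f assms(4) by (rule has_derivative_subset)
  ultimately have "((\<lambda>s. f (h s)) has_derivative (\<lambda>s. D (s *\<^sub>R w))) (at t within W)"
    by (rule has_derivative_in_compose)
  then show ?thesis
    using at_within_open[OF assms(3,2)] linear_scale[OF has_derivative_linear[OF f]]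
    by (simp add: has_vector_derivative_def)
qed

text \<open>The component \<open>z\<close> of \<open>w\<close> orthogonal to \<open>E\<close>
  satisfies \<open>z \<bullet> h t = 0\<close> near \<open>0\<close>; differentiating shows that
  \<open>z\<close> is orthogonal to itself.\<close>

lemma has_vector_derivative_in_subspace:
  assumes h: "(h has_vector_derivative w) (at 0)" and "subspace E"
    and "\<forall>\<^sub>F t in nhds 0. h t \<in> E"
  shows "w \<in> (E :: 'a::euclidean_space set)"
proof -
  obtain W where W: "open W" "0 \<in> W" "\<And>t. t \<in> W \<Longrightarrow> h t \<in> E"
    using assms(3) by (auto simp: eventually_nhds)
  obtain y z where y: "y \<in> span E" and z: "\<And>v. v \<in> span E \<Longrightarrow> orthogonal z v" and w: "w = y + z"
    using orthogonal_subspace_decomp_exists[of E w] by blast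
  have "((\<lambda>t. z \<bullet> h t) has_vector_derivative z \<bullet> w) (at 0)"
    by (rule bounded_linear.has_vector_derivative[OF bounded_linear_inner_right h])
  then have "((\<lambda>t. 0) has_vector_derivative z \<bullet> w) (at 0)"
    by (rule has_vector_derivative_transform_within_open[OF _ W(1,2)])
       (use W(3) z in \<open>auto simp: orthogonal_def span_base\<close>)
  then have "z \<bullet> w = 0"
    using has_vector_derivative_const vector_derivative_unique_at by blast
  then have "z = 0" using z[OF y] by (simp add: w inner_add_right orthogonal_def)
  then show ?thesis using y w \<open>subspace E\<close> by (metis add.right_neutral span_eq_iff)
qed

lemma smooth_on_has_derivative:
  assumes "smooth_on E U f"
  shows "\<exists>f'. \<forall>x\<in>U. (f has_derivative f' x) (at x within U)"
  using assms unfolding smooth_on_def by (metis C_k_on.simps(2))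

text \<open>The curves are images under \<open>\<psi>\<close> of lines in \<open>L\<close>, and
  \<open>T\<close> consists of their velocities. Tangent spaces are needed at every point near
  \<open>x0\<close>, since the perturbed minimizers move.\<close>

lemma smooth_manifold_near_tangent:
  fixes M :: "'a::euclidean_space set"
  assumes "smooth_manifold_near E M x0 c" and E: "subspace E"
  obtains U where "openin (top_of_set E) U" "x0 \<in> U"
    and "\<And>x. x \<in> M \<inter> U \<Longrightarrow> \<exists>T. subspace T \<and> T \<subseteq> E \<and> dim T + c = dim E \<and>
      (\<forall>w\<in>T. \<exists>h. h 0 = x \<and> (h has_vector_derivative w) (at 0) \<and> (\<forall>\<^sub>F t in nhds (0::real). h t \<in> M))"
proof -
  obtain U V \<phi> \<psi> L where UV: "openin (top_of_set E) U" "x0 \<in> U" "openin (top_of_set E) V"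
    and hom: "homeomorphism U V \<phi> \<psi>" and sm: "smooth_on E U \<phi>" "smooth_on E V \<psi>"
    and L: "subspace L" "L \<subseteq> E" "dim L + c = dim E" and flat: "\<phi> ` (M \<inter> U) = L \<inter> V"
    using assms(1) unfolding smooth_manifold_near_def by blast
  obtain \<phi>' where \<phi>': "\<And>x. x \<in> U \<Longrightarrow> (\<phi> has_derivative \<phi>' x) (at x within U)"
    using smooth_on_has_derivative[OF sm(1)] by blast
  obtain \<psi>' where \<psi>': "\<And>y. y \<in> V \<Longrightarrow> (\<psi> has_derivative \<psi>' y) (at y within V)"
    using smooth_on_has_derivative[OF sm(2)] by blast
  obtain O' where O': "open O'" "V = E \<inter> O'" using UV(3) by (auto simp: openin_open)
  have "U \<subseteq> E" using UV(1) openin_imp_subset by blast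
  show ?thesis
  proof (rule that[OF UV(1,2)])
    fix x assume x: "x \<in> M \<inter> U"
    define y where "y = \<phi> x"
    have y: "y \<in> L" "y \<in> V" using flat x by (auto simp: y_def)
    have \<psi>y: "\<psi> y = x" using hom x by (simp add: y_def homeomorphism_apply1)
    define D where "D = \<psi>' y"
    have "linear D" unfolding D_def using \<psi>'[OF y(2)] by (rule has_derivative_linear)
    define h where "h v t = \<psi> (y + t *\<^sub>R v)" for v and t :: real
    define W where "W v = (\<lambda>t. y + t *\<^sub>R v) -` O'" for v
    have W: "open (W v)" "0 \<in> W v" for v
      using y O' unfolding W_def
      by (auto intro!: open_vimage continuous_intros)
    have line: "y + t *\<^sub>R v \<in> V" if "v \<in> E" "t \<in> W v" for v t
      using that y O' E by (auto simp: W_def intro!: subspace_add subspace_scale)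
    have dline: "((\<lambda>t. y + t *\<^sub>R v) has_vector_derivative v) (at 0)" for v
      by (auto intro!: derivative_eq_intros)
    have dh: "(h v has_vector_derivative D v) (at 0)" if "v \<in> E" for v
      unfolding h_def D_def
      by (rule has_vector_derivative_chain_within[OF dline W, where f = \<psi> and U = V])
         (use line[OF that] \<psi>'[OF y(2)] in auto)
    have hU: "h v t \<in> U" if "v \<in> E" "t \<in> W v" for v t
      using line[OF that] hom by (auto simp: h_def homeomorphism_def)
    have \<phi>h: "\<phi> (h v t) = y + t *\<^sub>R v" if "v \<in> E" "t \<in> W v" for v t
      using line[OF that] hom by (simp add: h_def homeomorphism_apply2)
    \<comment> \<open>Both derivatives are determined only on \<open>E\<close>, so the identity is
      obtained by differentiating along a line in \<open>V\<close>. It makes \<open>D\<close>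
      injective on \<open>L\<close>, which preserves the dimension.\<close>
    have left_inv: "\<phi>' x (D v) = v" if "v \<in> E" for v
    proof -
      have h0: "h v 0 = x" by (simp add: h_def \<psi>y)
      have "((\<lambda>t. \<phi> (h v t)) has_vector_derivative \<phi>' x (D v)) (at 0)"
        by (rule has_vector_derivative_chain_within[OF dh[OF that] W, where f = \<phi> and U = U])
           (use hU[OF that] \<phi>'[of x] x h0 in auto)
      then have "((\<lambda>t. y + t *\<^sub>R v) has_vector_derivative \<phi>' x (D v)) (at 0)"
        by (rule has_vector_derivative_transform_within_open[OF _ W[of v]]) (simp add: \<phi>h that)
      then show ?thesis using dline vector_derivative_unique_at by blast
    qed
    have ev: "\<forall>\<^sub>F t in nhds 0. t \<in> W v" for v using W by (auto intro: eventually_nhds_in_open)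
    have "span L = L" using L(1) by (simp add: span_eq_iff)
    have "inj_on D (span L)"
      unfolding \<open>span L = L\<close> using left_inv L(2) by (intro inj_on_inverseI[where g = "\<phi>' x"]) auto
    then have "dim (D ` L) = dim L" using \<open>linear D\<close> by (rule dim_image_eq[rotated])
    moreover have "subspace (D ` L)" using \<open>linear D\<close> L(1) by (rule linear_subspace_image)
    moreover have "D ` L \<subseteq> E"
    proof safe
      fix v assume "v \<in> L"
      then have "v \<in> E" using L by blast
      show "D v \<in> E"
        using ev[of v] \<open>U \<subseteq> E\<close> hU[OF \<open>v \<in> E\<close>]
        by (intro has_vector_derivative_in_subspace[OF dh[OF \<open>v \<in> E\<close>] E])
           (auto elim!: eventually_mono)
    qed
    moreover have "\<exists>h. h 0 = x \<and> (h has_vector_derivative w) (at 0) \<and> (\<forall>\<^sub>F t in nhds (0::real). h t \<in> M)"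
      if w: "w \<in> D ` L" for w
    proof -
      obtain v where v: "v \<in> L" "w = D v" using w by blast
      have "v \<in> E" using v L by blast
      have "h v t \<in> M" if "t \<in> W v" for t
      proof -
        have "y + t *\<^sub>R v \<in> L \<inter> V"
          using line[OF \<open>v \<in> E\<close> that] y v L(1) by (auto intro!: subspace_add subspace_scale)
        then obtain x' where "x' \<in> M \<inter> U" "y + t *\<^sub>R v = \<phi> x'" using flat by blast
        then show ?thesis using hom by (simp add: h_def homeomorphism_apply1)
      qed
      then show ?thesis
        using dh[OF \<open>v \<in> E\<close>] ev[of v] v \<psi>y
        by (intro exI[of _ "h v"]) (auto simp: h_def elim!: eventually_mono)
    qed
    ultimately show "\<exists>T. subspace T \<and> T \<subseteq> E \<and> dim T + c = dim E \<and>
      (\<forall>w\<in>T. \<exists>h. h 0 = x \<and> (h has_vector_derivative w) (at 0) \<and> (\<forall>\<^sub>F t in nhds (0::real). h t \<in> M))"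
      using L(3) by (intro exI[of _ "D ` L"]) auto
  qed
qed

section \<open>First-order conditions on coordinate subspaces\<close>

lemma has_derivative_quadratic_form:
  fixes B :: "real^'n^'n"
  assumes "B \<in> sym_mats" and h: "(h has_derivative h') (at x within W)"
  shows "((\<lambda>t. h t \<bullet> (B *v h t)) has_derivative (\<lambda>t. 2 * (h' t \<bullet> (B *v h x)))) (at x within W)"
proof -
  have "((\<lambda>t. B *v h t) has_derivative (\<lambda>t. B *v h' t)) (at x within W)"
    by (rule bounded_linear.has_derivative[OF _ h]) simp
  from has_derivative_inner[OF h this] show ?thesis
    using sym_inner_swap[OF assms(1), of "h x"] by simp
qed

lemma curve_quadratic_form_local_min:
  fixes B :: "real^'n^'n"
  assumes "B \<in> sym_mats" and h: "(h has_vector_derivative w) (at 0)"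
    and min: "\<forall>\<^sub>F t in nhds 0. h 0 \<bullet> (B *v h 0) \<le> h t \<bullet> (B *v h t)"
  shows "w \<bullet> (B *v h 0) = 0"
proof -
  have "((\<lambda>t. h t \<bullet> (B *v h t)) has_derivative (\<lambda>t. 2 * ((t *\<^sub>R w) \<bullet> (B *v h 0)))) (at 0)"
    using h unfolding has_vector_derivative_def
    by (rule has_derivative_quadratic_form[OF assms(1)])
  then have D: "((\<lambda>t. h t \<bullet> (B *v h t)) has_real_derivative 2 * (w \<bullet> (B *v h 0))) (at 0)"
    by (simp add: has_field_derivative_def mult.left_commute[of 2] mult_commute_abs)
  obtain d where "d > 0" "\<And>t. dist t 0 < d \<Longrightarrow> h 0 \<bullet> (B *v h 0) \<le> h t \<bullet> (B *v h t)"
    using min by (auto simp: eventually_nhds_metric)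
  then have "2 * (w \<bullet> (B *v h 0)) = 0"
    by (intro DERIV_local_min[OF D]) (auto simp: dist_real_def abs_minus_commute)
  then show ?thesis by simp
qed

text \<open>The passage to the variables in \<open>S\<close>, kept inside the full space;
  \<open>g_restrict\<close> is \<open>g_map\<close> composed with it.\<close>

definition coord_proj :: "'n set \<Rightarrow> real^'n \<Rightarrow> real^'n" where
  "coord_proj S x = (\<chi> i. if i \<in> S then x $ i else 0)"

lemma linear_coord_proj: "linear (coord_proj S)"
  by (rule linearI) (auto simp: coord_proj_def vec_eq_iff)

lemma coord_proj_in: "coord_proj S x \<in> coord_subspace S"
  by (simp add: coord_proj_def coord_subspace_def)

lemma coord_proj_id: "x \<in> coord_subspace S \<Longrightarrow> coord_proj S x = x"
  by (auto simp: coord_proj_def coord_subspace_def vec_eq_iff)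

lemma inner_coord_proj: "u \<bullet> coord_proj S v = coord_proj S u \<bullet> v"
  by (auto simp: inner_vec_def coord_proj_def intro!: sum.cong)

lemma norm_coord_proj_le: "norm (coord_proj S x) \<le> norm x"
  by (rule norm_le_componentwise_cart) (auto simp: coord_proj_def)

lemma subspace_coord_subspace: "subspace (coord_subspace S)"
  by (auto simp: subspace_def coord_subspace_def)

lemma X_set_iff: "x \<in> X_set A b S \<longleftrightarrow> x \<in> coord_subspace S \<and> (\<forall>i. x \<bullet> (A i *v x) = b $ i)"
  by (auto simp: X_set_def coord_subspace_def g_map_def vec_eq_iff)

lemma sum_scaleR_matrix_mult:
  fixes A :: "'m \<Rightarrow> real^'n^'k"
  shows "(\<Sum>i\<in>I. d i *\<^sub>R A i) *v x = (\<Sum>i\<in>I. d i *\<^sub>R (A i *v x))"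
  by (induction I rule: infinite_finite_induct)
     (simp_all add: matrix_vector_mult_add_rdistrib scaleR_matrix_vector_assoc)

lemma inner_transpose_mult: "v \<bullet> (transpose G *v d) = d \<bullet> (G *v v)" for G :: "real^'n^'m"
  by (metis dot_lmul_matrix inner_commute transpose_matrix_vector)

text \<open>This is the gradient of \<open>d \<bullet> g_restrict A b S x\<close> in
  \<open>x\<close>. Hence the rank in ACQ is the dimension of the span of the vectors
  \<open>coord_proj S (A i *v x)\<close>.\<close>

lemma transpose_jacobian_g_restrict:
  fixes A :: "'m::finite \<Rightarrow> real^'n^'n"
  assumes A: "\<And>i. A i \<in> sym_mats" and x: "x \<in> coord_subspace S"
  shows "transpose (jacobian (g_restrict A b S) (at x)) *v d
    = 2 *\<^sub>R coord_proj S ((\<Sum>i\<in>UNIV. d $ i *\<^sub>R A i) *v x)"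
proof -
  have P: "(coord_proj S has_derivative coord_proj S) (at x)"
    using linear_coord_proj by (rule linear_imp_has_derivative)
  have "((\<lambda>z. coord_proj S z \<bullet> (A i *v coord_proj S z) - b $ i) has_derivative
      (\<lambda>v. 2 * (coord_proj S v \<bullet> (A i *v x)))) (at x)" for i
    using has_derivative_diff[OF has_derivative_quadratic_form[OF A[of i] P] has_derivative_const[of "b $ i"]] x
    by (simp add: coord_proj_id)
  then have D: "(g_restrict A b S has_derivative (\<lambda>v. \<chi> i. 2 * (coord_proj S v \<bullet> (A i *v x)))) (at x)"
    unfolding g_restrict_def coord_proj_def[symmetric] g_map_def
    by (subst has_derivative_componentwise_within) (auto simp: Basis_vec_def inner_axis)
  then have "(g_restrict A b S has_derivative (\<lambda>v. jacobian (g_restrict A b S) (at x) *v v)) (at x)"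
    using jacobian_works differentiableI by blast
  from has_derivative_unique[OF this D]
  have G: "(jacobian (g_restrict A b S) (at x) *v v) $ i = 2 * (coord_proj S v \<bullet> (A i *v x))" for v i
    by (simp add: fun_eq_iff)
  have "v \<bullet> (transpose (jacobian (g_restrict A b S) (at x)) *v d)
      = v \<bullet> (2 *\<^sub>R coord_proj S ((\<Sum>i\<in>UNIV. d $ i *\<^sub>R A i) *v x))" for v
  proof -
    have "v \<bullet> (transpose (jacobian (g_restrict A b S) (at x)) *v d)
        = d \<bullet> (jacobian (g_restrict A b S) (at x) *v v)"
      by (rule inner_transpose_mult)
    also have "\<dots> = (\<Sum>i\<in>UNIV. d $ i * (2 * (coord_proj S v \<bullet> (A i *v x))))"
      by (simp add: inner_vec_def[of d] G)
    also have "\<dots> = 2 * (coord_proj S v \<bullet> (\<Sum>i\<in>UNIV. d $ i *\<^sub>R (A i *v x)))"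
      by (simp add: inner_sum_right sum_distrib_left mult_ac)
    also have "(\<Sum>i\<in>UNIV. d $ i *\<^sub>R (A i *v x)) = (\<Sum>i\<in>UNIV. d $ i *\<^sub>R A i) *v x"
      by (simp add: sum_scaleR_matrix_mult)
    finally show ?thesis by (simp add: inner_coord_proj)
  qed
  then show ?thesis using vector_eq_ldot by blast
qed

lemma norm_sum_scaleR_mult_le:
  fixes A :: "'m::finite \<Rightarrow> real^'n^'n"
  shows "norm ((\<Sum>i\<in>UNIV. d $ i *\<^sub>R A i) *v u) \<le> (\<Sum>i\<in>UNIV. onorm ((*v) (A i))) * norm d * norm u"
proof -
  have "(\<Sum>i\<in>UNIV. d $ i *\<^sub>R A i) *v u = (\<Sum>i\<in>UNIV. d $ i *\<^sub>R (A i *v u))"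
    by (rule sum_scaleR_matrix_mult)
  also have "norm \<dots> \<le> (\<Sum>i\<in>UNIV. norm (d $ i *\<^sub>R (A i *v u)))" by (rule norm_sum)
  also have "\<dots> \<le> (\<Sum>i\<in>UNIV. onorm ((*v) (A i)) * (norm d * norm u))"
  proof (rule sum_mono)
    fix i
    have "norm (A i *v u) \<le> onorm ((*v) (A i)) * norm u"
      by (rule onorm) simp
    then have "\<bar>d $ i\<bar> * norm (A i *v u) \<le> norm d * (onorm ((*v) (A i)) * norm u)"
      using component_le_norm_cart[of d i] by (intro mult_mono) auto
    then show "norm (d $ i *\<^sub>R (A i *v u)) \<le> onorm ((*v) (A i)) * (norm d * norm u)"
      by (simp add: mult_ac)
  qed
  finally show ?thesis by (simp add: sum_distrib_right mult.assoc)
qed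

text \<open>No implicit function theorem is needed: at a point of the manifold near \<open>x0\<close> the gradients of
  the constraints are orthogonal to the tangent space, and by lower semicontinuity of the rank they
  still span a space of dimension at least the codimension, hence the whole normal space.\<close>

lemma ACQ_multipliers:
  fixes A :: "'m::finite \<Rightarrow> real^'n^'n"
  assumes "ACQ A b S x0" and A: "\<And>i. A i \<in> sym_mats"
  shows "\<exists>e>0. \<exists>s>0. \<forall>x B. x \<in> X_set A b S \<longrightarrow> norm (x - x0) < e \<longrightarrow> B \<in> sym_mats \<longrightarrow>
    (\<forall>\<^sub>F y in nhds x. y \<in> X_set A b S \<longrightarrow> x \<bullet> (B *v x) \<le> y \<bullet> (B *v y)) \<longrightarrow>
    (\<exists>d. s * norm d \<le> norm (coord_proj S (B *v x)) \<and>
      coord_proj S ((B - (\<Sum>i\<in>UNIV. d $ i *\<^sub>R A i)) *v x) = 0)"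
proof -
  define E where "E = coord_subspace S"
  define M where "M = X_set A b S"
  define G where "G = jacobian (g_restrict A b S) (at x0)"
  define R where "R x d = coord_proj S ((\<Sum>i\<in>UNIV. d $ i *\<^sub>R A i) *v x)" for x d
  \<comment> \<open>The constraint gradients may be linearly dependent. Multipliers are therefore
    taken from \<open>N\<close>, the orthogonal complement of the kernel of
    \<open>transpose G\<close>, on which they are controlled by the gradient they produce.\<close>
  define N where "N = range ((*v) G)"
  note P = linear_coord_proj[of S]
  obtain c where man: "smooth_manifold_near E M x0 c" and c: "rank G = c"
    using assms(1) unfolding ACQ_def E_def M_def G_def by blast
  have E: "subspace E" unfolding E_def by (rule subspace_coord_subspace)
  have x0: "x0 \<in> M" "x0 \<in> E" using man unfolding smooth_manifold_near_def by blast+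
  obtain U where U: "openin (top_of_set E) U" "x0 \<in> U"
    and tan: "\<And>x. x \<in> M \<inter> U \<Longrightarrow> \<exists>T. subspace T \<and> T \<subseteq> E \<and> dim T + c = dim E \<and>
      (\<forall>w\<in>T. \<exists>h. h 0 = x \<and> (h has_vector_derivative w) (at 0) \<and> (\<forall>\<^sub>F t in nhds (0::real). h t \<in> M))"
    using smooth_manifold_near_tangent[OF man E] by metis
  obtain e1 where e1: "e1 > 0" "\<And>x. x \<in> E \<Longrightarrow> dist x x0 < e1 \<Longrightarrow> x \<in> U"
    using U unfolding openin_euclidean_subtopology_iff by blast
  have linR: "linear (R x)" for x
  proof -
    have "linear (\<lambda>d. (\<Sum>i\<in>UNIV. d $ i *\<^sub>R A i) *v x)"
      by (rule linearI) (simp_all add: scaleR_left_distrib sum.distrib matrix_vector_mult_add_rdistrib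
          scaleR_matrix_vector_assoc scaleR_sum_right)
    from linear_compose[OF this P] show ?thesis by (simp add: R_def[abs_def] o_def)
  qed
  have N: "subspace N" unfolding N_def by (rule linear_subspace_image) auto
  have dimN: "dim N = c" using c by (simp add: N_def rank_dim_range)
  have GT: "transpose G *v d = 2 *\<^sub>R R x0 d" for d
    unfolding G_def R_def using x0(2) by (intro transpose_jacobian_g_restrict A) (simp add: E_def)
  have inj0: "d = 0" if dN: "d \<in> N" and zero: "R x0 d = 0" for d
  proof -
    obtain v where v: "d = G *v v" using dN unfolding N_def by blast
    have "d \<bullet> d = v \<bullet> (transpose G *v d)"
      by (metis inner_transpose_mult v)
    also have "\<dots> = 0" using zero by (simp add: GT del: transpose_matrix_vector)
    finally show ?thesis by simp
  qed
  obtain s where s: "s > 0" "\<And>d. d \<in> N \<Longrightarrow> s * norm d \<le> norm (R x0 d)"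
    using injective_imp_isometric[OF closed_subspace[OF N] N linear_conv_bounded_linear[THEN iffD1, OF linR[of x0]]] inj0
    by blast
  define K where "K = (\<Sum>i\<in>UNIV. onorm ((*v) (A i)))"
  have K: "0 \<le> K" unfolding K_def by (intro sum_nonneg onorm_pos_le) simp
  \<comment> \<open>The first bound keeps \<open>x\<close> in \<open>U\<close>; the second lets
    \<open>R x\<close> differ from \<open>R x0\<close> by at most half of the lower bound
    \<open>s\<close>. Adding 1 to \<open>K\<close> avoids division by zero.\<close>
  define e where "e = min e1 (s / (2 * (K + 1)))"
  have "e > 0" using e1 s K by (simp add: e_def)
  moreover have "s / 2 > 0" using s by simp
  moreover have "\<exists>d. s / 2 * norm d \<le> norm (coord_proj S (B *v x)) \<and>
        coord_proj S ((B - (\<Sum>i\<in>UNIV. d $ i *\<^sub>R A i)) *v x) = 0"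
    if x: "x \<in> M" "norm (x - x0) < e" and B: "B \<in> sym_mats"
      and min: "\<forall>\<^sub>F y in nhds x. y \<in> M \<longrightarrow> x \<bullet> (B *v x) \<le> y \<bullet> (B *v y)" for x B
  proof -
    have "x \<in> E" using x(1) by (simp add: M_def E_def X_set_iff)
    then have "x \<in> M \<inter> U" using x e1(2) by (simp add: e_def dist_norm)
    from tan[OF this] obtain T where T: "subspace T" "T \<subseteq> E" "dim T + c = dim E"
      and curve: "\<And>w. w \<in> T \<Longrightarrow> \<exists>h. h 0 = x \<and> (h has_vector_derivative w) (at 0) \<and>
        (\<forall>\<^sub>F t in nhds (0::real). h t \<in> M)"
      by blast
    have lower: "s / 2 * norm d \<le> norm (R x d)" if "d \<in> N" for d
    proof -
      have "R x d - R x0 d = coord_proj S ((\<Sum>i\<in>UNIV. d $ i *\<^sub>R A i) *v (x - x0))"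
        by (simp add: R_def matrix_vector_mult_diff_distrib linear_diff[OF P])
      also have "norm \<dots> \<le> norm ((\<Sum>i\<in>UNIV. d $ i *\<^sub>R A i) *v (x - x0))"
        by (rule norm_coord_proj_le)
      also have "\<dots> \<le> K * norm d * norm (x - x0)"
        unfolding K_def by (rule norm_sum_scaleR_mult_le)
      also have "\<dots> \<le> K * norm d * (s / (2 * (K + 1)))"
        using x(2) K by (intro mult_left_mono) (auto simp: e_def)
      also have "\<dots> = (K / (K + 1)) * (s / 2 * norm d)"
        using K by (simp add: field_simps)
      also have "\<dots> \<le> 1 * (s / 2 * norm d)"
        using K s by (intro mult_right_mono) auto
      finally show ?thesis
        using s(2)[OF that] norm_triangle_ineq2[of "R x0 d" "R x d"] by (simp add: norm_minus_commute)
    qed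
    have injR: "inj_on (R x) (span N)"
      unfolding linear_inj_on_iff_eq_0[OF linR subspace_span]
    proof safe
      fix d assume "d \<in> span N" "R x d = 0"
      then have "s / 2 * norm d \<le> 0" using lower[of d] N by (simp add: span_eq_iff[THEN iffD2])
      then show "d = 0" using s by (simp add: mult_le_0_iff)
    qed
    define V where "V = {y \<in> E. \<forall>w\<in>T. orthogonal w y}"
    have "dim V + dim T = dim E"
      unfolding V_def by (rule dim_subspace_orthogonal_to_vectors[OF T(1) E T(2)])
    then have "dim V = c" using T(3) by simp
    have V: "subspace V"
      using E by (auto simp: V_def subspace_def orthogonal_clauses)
    \<comment> \<open>Used twice: for \<open>B\<close>, and for combinations of the
      \<open>A i\<close>, whose forms are constant on \<open>M\<close> and thus trivially minimal at
      \<open>x\<close>.\<close>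
    have normal: "coord_proj S (Q *v x) \<in> V"
      if "Q \<in> sym_mats" and "\<forall>\<^sub>F y in nhds x. y \<in> M \<longrightarrow> x \<bullet> (Q *v x) \<le> y \<bullet> (Q *v y)" for Q
      unfolding V_def
    proof safe
      show "coord_proj S (Q *v x) \<in> E" unfolding E_def by (rule coord_proj_in)
      fix w assume "w \<in> T"
      from curve[OF this] obtain h where h: "h 0 = x" "(h has_vector_derivative w) (at 0)"
        "\<forall>\<^sub>F t in nhds (0::real). h t \<in> M"
        by blast
      have "(h \<longlongrightarrow> h 0) (nhds 0)"
        using has_vector_derivative_continuous[OF h(2)] by (simp add: continuous_at tendsto_nhds_iff)
      then have "filterlim h (nhds x) (nhds 0)" using h(1) by simp
      from eventually_compose_filterlim[OF that(2) this] h(3)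
      have "\<forall>\<^sub>F t in nhds 0. h 0 \<bullet> (Q *v h 0) \<le> h t \<bullet> (Q *v h t)"
        by eventually_elim (simp add: h(1))
      then have "w \<bullet> (Q *v h 0) = 0"
        by (rule curve_quadratic_form_local_min[OF that(1) h(2)])
      moreover have "coord_proj S w = w" using \<open>w \<in> T\<close> T(2) by (auto simp: E_def coord_proj_id)
      ultimately show "orthogonal w (coord_proj S (Q *v x))"
        by (simp add: orthogonal_def inner_coord_proj h(1))
    qed
    have "R x d \<in> V" for d
      unfolding R_def
    proof (rule normal)
      show "(\<Sum>i\<in>UNIV. d $ i *\<^sub>R A i) \<in> sym_mats" by (intro sym_mats_intros A)
      have "y \<bullet> ((\<Sum>i\<in>UNIV. d $ i *\<^sub>R A i) *v y) = d \<bullet> b" if "y \<in> M" for y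
      proof -
        have "y \<bullet> ((\<Sum>i\<in>UNIV. d $ i *\<^sub>R A i) *v y) = (\<Sum>i\<in>UNIV. d $ i * (y \<bullet> (A i *v y)))"
          by (simp add: inner_outer[symmetric] inner_sum_left)
        then show ?thesis using that by (simp add: M_def X_set_iff inner_vec_def[of d])
      qed
      then show "\<forall>\<^sub>F y in nhds x. y \<in> M \<longrightarrow> x \<bullet> ((\<Sum>i\<in>UNIV. d $ i *\<^sub>R A i) *v x)
          \<le> y \<bullet> ((\<Sum>i\<in>UNIV. d $ i *\<^sub>R A i) *v y)"
        using x(1) by simp
    qed
    then have "R x ` N \<subseteq> V" by blast
    moreover have "dim (R x ` N) = c" using dim_image_eq[OF linR injR] dimN by simp
    moreover have "subspace (R x ` N)" using linR N by (rule linear_subspace_image)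
    \<comment> \<open>Both spaces have dimension \<open>c\<close>: the gradients fill the normal
      space, so the gradient of the form of \<open>B\<close> is a combination of them.\<close>
    ultimately have "R x ` N = V"
      using V \<open>dim V = c\<close> by (intro subspace_dim_equal) auto
    then obtain d where d: "d \<in> N" "coord_proj S (B *v x) = R x d"
      using normal[OF B min] by blast
    then have "coord_proj S ((B - (\<Sum>i\<in>UNIV. d $ i *\<^sub>R A i)) *v x) = 0"
      by (simp add: matrix_vector_mult_diff_rdistrib linear_diff[OF P] R_def)
    then show ?thesis using lower[OF d(1)] d(2) by auto
  qed
  ultimately show ?thesis unfolding M_def by blast
qed

section \<open>Perturbation of the objective\<close>

lemma strict_minimizer_stable:
  fixes C :: "nat \<Rightarrow> real^'n^'n"
  assumes "compact K" "x0 \<in> K" and C: "C \<longlonglongrightarrow> C0"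
    and strict: "\<And>y. \<lbrakk>y \<in> K; y \<noteq> x0\<rbrakk> \<Longrightarrow> x0 \<bullet> (C0 *v x0) < y \<bullet> (C0 *v y)"
    and x: "\<And>n. x n \<in> K" "\<And>n y. y \<in> K \<Longrightarrow> x n \<bullet> (C n *v x n) \<le> y \<bullet> (C n *v y)"
  shows "x \<longlonglongrightarrow> x0"
proof (rule tendstoI)
  fix e :: real assume "e > 0"
  obtain R where R: "R > 0" "\<And>y. y \<in> K \<Longrightarrow> norm y \<le> R"
    using compact_imp_bounded[OF \<open>compact K\<close>] bounded_pos by metis
  define K' where "K' = K - ball x0 e"
  have "compact K'" unfolding K'_def using \<open>compact K\<close> by (simp add: compact_diff)
  obtain m where m: "m > 0" "\<And>y. y \<in> K' \<Longrightarrow> x0 \<bullet> (C0 *v x0) + m \<le> y \<bullet> (C0 *v y)"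
  proof (cases "K' = {}")
    case True
    then show ?thesis using that[of 1] by simp
  next
    case False
    obtain z where z: "z \<in> K'" "\<forall>y\<in>K'. z \<bullet> (C0 *v z) \<le> y \<bullet> (C0 *v y)"
      using continuous_attains_inf[OF \<open>compact K'\<close> False continuous_on_quadratic_form] by blast
    then have "x0 \<bullet> (C0 *v x0) < z \<bullet> (C0 *v z)"
      using \<open>e > 0\<close> by (intro strict) (auto simp: K'_def)
    then show ?thesis using z(2) that[of "z \<bullet> (C0 *v z) - x0 \<bullet> (C0 *v x0)"] by auto
  qed
  \<comment> \<open>On \<open>K\<close> the forms of \<open>C n\<close> and \<open>C0\<close> then
    differ by less than \<open>m / 2\<close>, so the comparisons at \<open>x n\<close> and at
    \<open>x0\<close> together cannot use up the gap \<open>m\<close>.\<close>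
  have "m / (2 * R\<^sup>2) > 0" using m(1) R(1) by simp
  from tendstoD[OF C this] show "\<forall>\<^sub>F n in sequentially. dist (x n) x0 < e"
  proof eventually_elim
    case (elim n)
    have near: "\<bar>y \<bullet> (C n *v y) - y \<bullet> (C0 *v y)\<bar> < m / 2" if "y \<in> K" for y
    proof -
      have "y \<bullet> (C n *v y) - y \<bullet> (C0 *v y) = y \<bullet> ((C n - C0) *v y)"
        by (simp add: matrix_vector_mult_diff_rdistrib inner_diff_right)
      also have "\<bar>\<dots>\<bar> \<le> norm (C n - C0) * (norm y)\<^sup>2" by (rule abs_quadratic_form_le)
      also have "\<dots> \<le> norm (C n - C0) * R\<^sup>2"
        using R(2)[OF that] by (intro mult_left_mono power_mono) auto
      also have "\<dots> < m / (2 * R\<^sup>2) * R\<^sup>2"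
        using elim R(1) by (intro mult_strict_right_mono) (auto simp: dist_norm)
      also have "\<dots> = m / 2" using R(1) by simp
      finally show ?thesis .
    qed
    have "x n \<notin> K'"
    proof
      assume "x n \<in> K'"
      from m(2)[OF this] near[OF x(1)[of n]] near[OF \<open>x0 \<in> K\<close>] x(2)[OF \<open>x0 \<in> K\<close>, of n]
      show False by linarith
    qed
    then show ?case using x(1)[of n] by (auto simp: K'_def dist_commute)
  qed
qed

lemma lagrangian_quadratic_form:
  fixes A :: "'m::finite \<Rightarrow> real^'n^'n" and C :: "real^'n^'n"
  assumes "\<And>i. x \<bullet> (A i *v x) = b $ i"
  shows "x \<bullet> ((C - (\<Sum>i\<in>UNIV. l $ i *\<^sub>R A i)) *v x) = x \<bullet> (C *v x) - l \<bullet> b"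
  using assms
  by (simp add: matrix_vector_mult_diff_rdistrib inner_diff_right sum_scaleR_matrix_mult
      inner_sum_right inner_vec_def[of l])

lemma quadratic_form_shift:
  "x \<bullet> ((C - m *\<^sub>R mat 1) *v x) = x \<bullet> (C *v x) - m * (norm x)\<^sup>2" for x :: "real^'n"
  by (simp add: matrix_vector_mult_diff_rdistrib inner_diff_right
      scaleR_matrix_vector_assoc[symmetric] power2_norm_eq_inner)

lemma psd_mat_1: "psd (mat 1)"
  by (simp add: psd_def mat_sym)

text \<open>For \<open>b = 0\<close>, \<open>m\<close> is the Rayleigh quotient of \<open>C\<close>
  at \<open>x\<close>, the multiplier of the norm constraint. If it is negative, \<open>x\<close>
  spans a ray along which the objective is unbounded below; otherwise \<open>m\<close> times the
  trace of \<open>X\<close> is a nonnegative addition to the gap, and the value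
  \<open>0 = l \<bullet> b\<close> is attained at the origin.\<close>

lemma exact_if_dual_certificate:
  fixes A :: "'m::finite \<Rightarrow> real^'n^'n"
  defines "Qt \<equiv> \<lambda>C m l Z k. C - m *\<^sub>R mat 1 - (\<Sum>i\<in>UNIV. l $ i *\<^sub>R A i) - (real k *\<^sub>R diag_part Z - Z)"
  assumes x: "l0norm x = k" "\<And>i. x \<bullet> (A i *v x) = b $ i"
    and "psd (Qt C m l Z k)" and ker: "\<And>v. v \<bullet> (Qt C m l Z k *v v) = 0 \<Longrightarrow> \<exists>a. v = a *\<^sub>R x"
    and "psd Z" and compl: "x \<bullet> ((C - m *\<^sub>R mat 1 - (\<Sum>i\<in>UNIV. l $ i *\<^sub>R A i)) *v x) = 0"
    and m: "m = (if b = 0 then (x \<bullet> (C *v x)) / (norm x)\<^sup>2 else 0)"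
  shows "exact C A b k"
proof -
  have xfeas: "P_feasible A b k x" using x by (simp add: P_feasible_def)
  have obj: "x \<bullet> (C *v x) - m * (norm x)\<^sup>2 = l \<bullet> b"
    using compl lagrangian_quadratic_form[where x = x and A = A and b = b, OF x(2)]
    by (simp add: quadratic_form_shift)
  show ?thesis
  proof (cases "b = 0 \<and> P_obj C x < 0")
    case True
    then show ?thesis using exact_if_unbounded xfeas by blast
  next
    case False
    then have "m \<ge> 0" by (auto simp: m P_obj_def)
    define y where "y = (if b = 0 then 0 else x)"
    have y: "P_feasible A b k y" "P_obj C y = l \<bullet> b"
      using xfeas obj m by (auto simp: y_def P_feasible_def P_obj_def l0norm_def supp_def)
    show ?thesis
    proof (rule exact_if_certificate[OF assms(4) ker _ y(1)])
      show "l0norm x \<le> k" using x by simp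
      fix X assume X: "Q_feasible A b k X"
      have "(real k *\<^sub>R diag_part Z - Z) \<bullet> X = Z \<bullet> (real k *\<^sub>R diag_part X - X)"
        by (simp add: inner_diff_left inner_diff_right inner_diag_part)
      also have "\<dots> \<ge> 0" using psd_inner_nonneg[OF \<open>psd Z\<close>] Q_feasible_psd(2)[OF X] by blast
      finally have 1: "0 \<le> (real k *\<^sub>R diag_part Z - Z) \<bullet> X" .
      have 2: "0 \<le> m * (mat 1 \<bullet> X)"
        using \<open>m \<ge> 0\<close> psd_inner_nonneg[OF psd_mat_1 Q_feasible_psd(1)[OF X]] by simp
      have 3: "(\<Sum>i\<in>UNIV. l $ i *\<^sub>R A i) \<bullet> X = l \<bullet> b"
        using Q_feasible_psd(3)[OF X] by (simp add: inner_sum_left inner_vec_def[of l])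
      have "C \<bullet> X = Qt C m l Z k \<bullet> X + m * (mat 1 \<bullet> X) + l \<bullet> b + (real k *\<^sub>R diag_part Z - Z) \<bullet> X"
        unfolding Qt_def 3[symmetric] by (simp add: inner_diff_left)
      then show "P_obj C y + Qt C m l Z k \<bullet> X \<le> Q_obj C X"
        using 1 2 by (simp add: y Q_obj_def frob_eq_inner)
    qed auto
  qed
qed

text \<open>By symmetry the kernel is the orthogonal complement of the range, so its dimension is
  the corank.\<close>

lemma corank_one_null:
  fixes Q :: "real^'n^'n"
  assumes "Q \<in> sym_mats" "corank Q = 1" "Q *v x = 0" "x \<noteq> 0" "Q *v v = 0"
  shows "\<exists>a. v = a *\<^sub>R x"
proof -
  define N where "N = {y. Q *v y = 0}"
  have "N = {y \<in> UNIV. \<forall>z \<in> range ((*v) Q). orthogonal z y}"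
  proof safe
    fix y z assume "y \<in> N"
    then show "orthogonal (Q *v z) y"
      using sym_inner_swap[OF assms(1), of y z] by (simp add: N_def orthogonal_def inner_commute)
  next
    fix y assume "\<forall>z \<in> range ((*v) Q). orthogonal z y"
    then have "orthogonal (Q *v (Q *v y)) y" by blast
    then show "y \<in> N"
      using sym_inner_swap[OF assms(1), of y "Q *v y"] by (simp add: N_def orthogonal_def inner_commute)
  qed auto
  moreover have "subspace (range ((*v) Q))" by (rule linear_subspace_image) auto
  ultimately have "dim N + rank Q = CARD('n)"
    using dim_subspace_orthogonal_to_vectors[of "range ((*v) Q)" UNIV]
    by (simp add: rank_dim_range)
  then have dimN: "dim N = 1" using assms(2) by (simp add: corank_def)
  have N: "subspace N" unfolding N_def by (simp add: subspace_def matrix_vector_right_distrib matrix_vector_mult_scaleR)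
  have "dim (span {x}) = 1"
    using assms(4) by (simp add: dim_eq_card_independent)
  moreover have "span {x} \<subseteq> N" using N assms(3) by (intro span_minimal) (auto simp: N_def)
  ultimately have "span {x} = N"
    using N dimN by (intro subspace_dim_equal) auto
  then have "v \<in> span {x}" using assms(5) by (simp add: N_def)
  then show ?thesis by (auto simp: span_singleton)
qed

lemma closed_X_set: "closed (X_set A b S)"
proof -
  have "X_set A b S = coord_subspace S \<inter> (\<Inter>i. {x. x \<bullet> (A i *v x) = b $ i})"
    by (auto simp: X_set_iff)
  then show ?thesis
    by (simp only:)
       (intro closed_Int closed_INT ballI closed_Collect_eq continuous_intros
        closed_subspace subspace_coord_subspace)
qed

lemma X_set_scaleR: "x \<in> X_set A 0 S \<Longrightarrow> a *\<^sub>R x \<in> X_set A 0 S"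
  by (auto simp: X_set_iff matrix_vector_mult_scaleR intro: subspace_scale[OF subspace_coord_subspace])

text \<open>If \<open>b = 0\<close>, the feasible set is a cone and \<open>x0\<close> is not a strict minimizer on it. Minimizing
  over the sphere instead produces an extra multiplier for the norm, which the shift absorbs.\<close>

lemma local_min_shifted:
  fixes x x0 :: "real^'n" and A b S
  defines "K \<equiv> X_set A b S \<inter> cball x0 (norm x0 / 2) \<inter> {y. b = 0 \<longrightarrow> norm y = norm x0}"
  assumes "x \<in> K" and near: "norm (x - x0) < norm x0 / 2"
    and min: "\<And>y. y \<in> K \<Longrightarrow> x \<bullet> (C *v x) \<le> y \<bullet> (C *v y)"
    and m: "m = (if b = 0 then (x \<bullet> (C *v x)) / (norm x)\<^sup>2 else 0)"
  shows "\<forall>\<^sub>F y in nhds x. y \<in> X_set A b S \<longrightarrow>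
    x \<bullet> ((C - m *\<^sub>R mat 1) *v x) \<le> y \<bullet> ((C - m *\<^sub>R mat 1) *v y)"
proof (cases "b = 0")
  case False
  have "\<forall>\<^sub>F y in nhds x. y \<in> ball x0 (norm x0 / 2)"
    using near by (intro eventually_nhds_in_open) (auto simp: dist_norm norm_minus_commute)
  then show ?thesis
    by eventually_elim (use False m min in \<open>auto simp: K_def\<close>)
next
  case True
  define r where "r = norm x0"
  have r: "norm x = r" using \<open>x \<in> K\<close> True by (simp add: K_def r_def)
  have "r > 0" using near norm_ge_zero[of "x - x0"] unfolding r_def by linarith
  \<comment> \<open>Radial retraction onto the sphere; it fixes \<open>x\<close> and preserves the
    cone. By homogeneity, minimality at \<open>f y\<close> becomes the inequality
    \<open>m * (norm y)\<^sup>2 \<le> y \<bullet> (C *v y)\<close> at \<open>y\<close>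
    itself.\<close>
  define f where "f = (\<lambda>y :: real^'n. (r / norm y) *\<^sub>R y)"
  have "f x = x" using r \<open>r > 0\<close> by (simp add: f_def)
  have "x \<noteq> 0" using r \<open>r > 0\<close> by auto
  then have "isCont f x" unfolding f_def by (intro continuous_intros) auto
  then have "(f \<longlongrightarrow> f x) (nhds x)" by (simp add: continuous_at tendsto_nhds_iff)
  then have "\<forall>\<^sub>F y in nhds x. f y \<in> ball x0 (norm x0 / 2)"
    using near by (intro topological_tendstoD) (auto simp: \<open>f x = x\<close> dist_norm norm_minus_commute)
  moreover have "\<forall>\<^sub>F y in nhds x. y \<noteq> 0"
    using \<open>x \<noteq> 0\<close> by (intro t1_space_nhds)
  ultimately show ?thesis
  proof eventually_elim
    case (elim y)
    show ?case
    proof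
      assume "y \<in> X_set A b S"
      then have "f y \<in> K"
        using elim True \<open>r > 0\<close> by (auto simp: K_def f_def r_def intro: X_set_scaleR)
      from min[OF this] have "m * r\<^sup>2 \<le> (r / norm y)\<^sup>2 * (y \<bullet> (C *v y))"
        using \<open>r > 0\<close> by (simp add: m True r f_def matrix_vector_mult_scaleR power2_eq_square)
      then have "m * (norm y)\<^sup>2 \<le> y \<bullet> (C *v y)"
        using \<open>r > 0\<close> elim by (simp add: power_divide field_simps)
      moreover have "x \<bullet> (C *v x) = m * (norm x)\<^sup>2" using \<open>x \<noteq> 0\<close> by (simp add: m True)
      ultimately show "x \<bullet> ((C - m *\<^sub>R mat 1) *v x) \<le> y \<bullet> ((C - m *\<^sub>R mat 1) *v y)"
        by (simp add: quadratic_form_shift)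
    qed
  qed
qed

section \<open>Limits of supports, entrywise inverses and multipliers\<close>

lemma coord_subspace_supp: "x \<in> coord_subspace S \<longleftrightarrow> supp x \<subseteq> S"
  by (auto simp: coord_subspace_def supp_def)

lemma eventually_supp_eq:
  fixes x0 :: "real^'n"
  assumes x: "(x \<longlongrightarrow> x0) F" and "\<And>n. x n \<in> coord_subspace (supp x0)"
  shows "\<forall>\<^sub>F n in F. supp (x n) = supp x0"
proof -
  have "\<forall>\<^sub>F n in F. \<forall>i\<in>supp x0. x n $ i \<noteq> 0"
    by (intro eventually_ball_finite ballI tendsto_imp_eventually_ne[OF tendsto_vec_nth[OF x]])
       (auto simp: supp_def)
  then show ?thesis
    by eventually_elim (use assms(2) in \<open>auto simp: coord_subspace_supp\<close>, auto simp: supp_def)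
qed

text \<open>The discontinuity of \<open>inverse\<close> at \<open>0\<close> does no harm: off the
  support of \<open>x0\<close> all entries are identically zero.\<close>

lemma tendsto_entrywise_inverse:
  fixes x0 :: "real^'n"
  assumes x: "(x \<longlongrightarrow> x0) F" and "\<And>n. x n \<in> coord_subspace (supp x0)"
  shows "((\<lambda>n. \<chi> i. inverse (x n $ i)) \<longlongrightarrow> (\<chi> i. inverse (x0 $ i))) F"
proof (rule tendsto_vec_lambda)
  fix i
  show "((\<lambda>n. inverse (x n $ i)) \<longlongrightarrow> inverse (x0 $ i)) F"
  proof (cases "x0 $ i = 0")
    case True
    then have "x n $ i = 0" for n
      using assms(2)[of n] by (auto simp: coord_subspace_def supp_def)
    then show ?thesis using True by simp
  qed (intro tendsto_intros x)
qed

lemma tendsto_diag_part [tendsto_intros]: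
  "(Z \<longlongrightarrow> Z0) F \<Longrightarrow> ((\<lambda>n. diag_part (Z n)) \<longlongrightarrow> diag_part Z0) F"
  using linear_diag_part bounded_linear.tendsto linear_conv_bounded_linear by blast

lemma eventually_choose_null_sequence:
  assumes "\<forall>\<^sub>F n in sequentially. \<exists>z::'b::real_normed_vector. P n z \<and> norm z \<le> c n"
    and "c \<longlonglongrightarrow> 0"
  shows "\<exists>z. (\<forall>\<^sub>F n in sequentially. P n (z n)) \<and> z \<longlonglongrightarrow> 0"
proof -
  have "\<forall>n. \<exists>z. (\<exists>z::'b. P n z \<and> norm z \<le> c n) \<longrightarrow> P n z \<and> norm z \<le> c n" by blast
  from choice[OF this] obtain z
    where "\<forall>n. (\<exists>z. P n z \<and> norm z \<le> c n) \<longrightarrow> P n (z n) \<and> norm (z n) \<le> c n" ..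
  with assms(1) have z: "\<forall>\<^sub>F n in sequentially. P n (z n) \<and> norm (z n) \<le> c n"
    by (auto elim!: eventually_mono)
  then have "z \<longlonglongrightarrow> 0"
    by (intro Lim_null_comparison[OF _ assms(2)]) (auto elim!: eventually_mono)
  then show ?thesis using z by (auto elim!: eventually_mono)
qed

lemma eventually_exact:
  fixes A :: "'m::finite \<Rightarrow> real^'n^'n" and C :: "nat \<Rightarrow> real^'n^'n"
  assumes A: "\<And>i. A i \<in> sym_mats" and acq: "ACQ A b (supp x0) x0"
    and feas: "\<And>i. x0 \<bullet> (A i *v x0) = b $ i" and "x0 \<noteq> 0"
    and Q0: "Q0 = C0 - (\<Sum>i\<in>UNIV. l0 $ i *\<^sub>R A i)" "psd Q0" "Q0 *v x0 = 0"
    and ker: "\<And>v. Q0 *v v = 0 \<Longrightarrow> \<exists>a. v = a *\<^sub>R x0"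
    and C: "C \<longlonglongrightarrow> C0" "\<And>n. C n \<in> sym_mats"
  shows "\<forall>\<^sub>F n in sequentially. exact (C n) A b (l0norm x0)"
proof -
  define S where "S = supp x0"
  define M where "M = X_set A b S"
  define k where "k = l0norm x0"
  \<comment> \<open>By evenness \<open>- x0\<close> has the same objective value as
    \<open>x0\<close>; half of its norm as radius excludes both \<open>- x0\<close> and
    \<open>0\<close>.\<close>
  define K where "K = M \<inter> cball x0 (norm x0 / 2) \<inter> {y. b = 0 \<longrightarrow> norm y = norm x0}"
  have M: "y \<bullet> (A i *v y) = b $ i" if "y \<in> M" for y i using that by (simp add: M_def X_set_iff)
  have "k > 0" using \<open>x0 \<noteq> 0\<close> by (auto simp: k_def l0norm_def supp_def vec_eq_iff card_gt_0_iff)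
  have x0M: "x0 \<in> M" using feas by (simp add: M_def X_set_iff S_def coord_subspace_supp)
  then have x0K: "x0 \<in> K" by (simp add: K_def)
  have Q0form: "y \<bullet> (Q0 *v y) = y \<bullet> (C0 *v y) - l0 \<bullet> b" if "y \<in> M" for y
    unfolding Q0(1) by (rule lagrangian_quadratic_form[OF M[OF that]])
  have C0x0: "x0 \<bullet> (C0 *v x0) = l0 \<bullet> b" using Q0form[OF x0M] Q0(3) by simp
  have "compact K"
  proof -
    have "closed {y::real^'n. b = 0 \<longrightarrow> norm y = norm x0}"
      by (cases "b = 0") (auto intro!: closed_Collect_eq continuous_intros)
    then have "compact (cball x0 (norm x0 / 2) \<inter> (M \<inter> {y. b = 0 \<longrightarrow> norm y = norm x0}))"
      using closed_X_set unfolding M_def by (intro compact_Int_closed closed_Int) auto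
    then show ?thesis by (simp add: K_def Int_ac)
  qed
  \<comment> \<open>Failure puts \<open>y\<close> on the line through \<open>x0\<close>. The radius
    of the ball makes its factor \<open>a\<close> positive, and either the sphere or a nonzero
    \<open>b $ i\<close> then forces \<open>a = 1\<close>.\<close>
  have strict: "x0 \<bullet> (C0 *v x0) < y \<bullet> (C0 *v y)" if "y \<in> K" "y \<noteq> x0" for y
  proof (rule ccontr)
    assume le: "\<not> ?thesis"
    have "y \<in> M" using that by (simp add: K_def)
    then have "y \<bullet> (Q0 *v y) \<le> 0" using le Q0form C0x0 by simp
    then have "y \<bullet> (Q0 *v y) = 0" using Q0(2) by (auto simp: psd_def intro: antisym)
    then obtain a where a: "y = a *\<^sub>R x0" using ker psd_null[OF Q0(2)] by blast
    have "norm ((a - 1) *\<^sub>R x0) \<le> norm x0 / 2"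
      using that(1) by (simp add: K_def a dist_norm scaleR_left_diff_distrib norm_minus_commute)
    then have "\<bar>a - 1\<bar> * norm x0 \<le> 1 / 2 * norm x0" by simp
    then have "\<bar>a - 1\<bar> \<le> 1 / 2" using \<open>x0 \<noteq> 0\<close> by (simp only: mult_le_cancel_right) auto
    then have "a > 0" by linarith
    have "a = 1"
    proof (cases "b = 0")
      case True
      then have "\<bar>a\<bar> * norm x0 = norm x0" using that(1) by (simp add: K_def a)
      then show ?thesis using \<open>a > 0\<close> \<open>x0 \<noteq> 0\<close> by simp
    next
      case False
      then obtain i where "b $ i \<noteq> 0" by (auto simp: vec_eq_iff)
      moreover have "a * a * b $ i = b $ i"
        using M[OF \<open>y \<in> M\<close>, of i] feas[of i] by (simp add: a matrix_vector_mult_scaleR)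
      ultimately have "a * a = 1" by simp
      then show ?thesis using \<open>a > 0\<close> by (simp add: square_eq_1_iff)
    qed
    then show False using a that(2) by simp
  qed
  have "\<exists>x\<in>K. \<forall>y\<in>K. x \<bullet> (C n *v x) \<le> y \<bullet> (C n *v y)" for n
    using continuous_attains_inf[OF \<open>compact K\<close> _ continuous_on_quadratic_form] x0K by blast
  then obtain x where xK: "\<And>n. x n \<in> K"
    and min: "\<And>n y. y \<in> K \<Longrightarrow> x n \<bullet> (C n *v x n) \<le> y \<bullet> (C n *v y)"
    by metis
  have x: "x \<longlonglongrightarrow> x0"
    using strict_minimizer_stable[OF \<open>compact K\<close> x0K C(1) strict xK min] by blast
  have xM: "x n \<in> M" and xE: "x n \<in> coord_subspace (supp x0)" for n
    using xK[of n] by (auto simp: K_def M_def X_set_iff S_def)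
  define m where "m n = (if b = 0 then (x n \<bullet> (C n *v x n)) / (norm (x n))\<^sup>2 else 0)" for n
  have m: "m \<longlonglongrightarrow> 0"
  proof (cases "b = 0")
    case True
    have "(\<lambda>n. (x n \<bullet> (C n *v x n)) / (norm (x n))\<^sup>2) \<longlonglongrightarrow> (x0 \<bullet> (C0 *v x0)) / (norm x0)\<^sup>2"
      using \<open>x0 \<noteq> 0\<close> by (intro tendsto_intros x C) auto
    then show ?thesis using True C0x0 by (simp add: m_def[abs_def])
  qed (simp add: m_def[abs_def])
  \<comment> \<open>With \<open>l0\<close> already subtracted, the multiplier \<open>d\<close> below
    is a correction to \<open>l0\<close>, bounded by a constant times the norm of
    \<open>B n *v x n\<close>. This tends to \<open>Q0 *v x0 = 0\<close>, hence so does
    \<open>d\<close>.\<close>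
  define B where "B n = C n - m n *\<^sub>R mat 1 - (\<Sum>i\<in>UNIV. l0 $ i *\<^sub>R A i)" for n
  have "B \<longlonglongrightarrow> C0 - 0 *\<^sub>R mat 1 - (\<Sum>i\<in>UNIV. l0 $ i *\<^sub>R A i)"
    unfolding B_def[abs_def] by (intro tendsto_diff tendsto_scaleR tendsto_const C m)
  then have B: "B \<longlonglongrightarrow> Q0" by (simp add: Q0(1))
  have Bsym: "B n \<in> sym_mats" for n unfolding B_def by (intro sym_mats_intros C mat_sym A)
  obtain e s where "e > 0" "s > 0" and mult0: "\<forall>y B. y \<in> M \<longrightarrow> norm (y - x0) < e \<longrightarrow>
      B \<in> sym_mats \<longrightarrow> (\<forall>\<^sub>F z in nhds y. z \<in> M \<longrightarrow> y \<bullet> (B *v y) \<le> z \<bullet> (B *v z)) \<longrightarrow>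
      (\<exists>d. s * norm d \<le> norm (coord_proj S (B *v y)) \<and>
        coord_proj S ((B - (\<Sum>i\<in>UNIV. d $ i *\<^sub>R A i)) *v y) = 0)"
    using ACQ_multipliers[OF acq A, folded S_def, folded M_def] by blast
  note mult = mult0[rule_format]
  \<comment> \<open>The second term places \<open>x n\<close> in the interior of the ball, so that
    minimality over \<open>K\<close> becomes local minimality of the shifted form over
    \<open>M\<close>.\<close>
  have "min e (norm x0 / 2) > 0" using \<open>e > 0\<close> \<open>x0 \<noteq> 0\<close> by simp
  from tendstoD[OF x this]
  have ex_d: "\<forall>\<^sub>F n in sequentially. \<exists>d. coord_proj S ((B n - (\<Sum>i\<in>UNIV. d $ i *\<^sub>R A i)) *v x n) = 0
      \<and> norm d \<le> norm (B n *v x n) / s"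
  proof eventually_elim
    case (elim n)
    have "\<forall>\<^sub>F z in nhds (x n). z \<in> X_set A b S \<longrightarrow>
        x n \<bullet> ((C n - m n *\<^sub>R mat 1) *v x n) \<le> z \<bullet> ((C n - m n *\<^sub>R mat 1) *v z)"
      using elim xK[of n] min unfolding K_def M_def
      by (intro local_min_shifted) (auto simp: m_def dist_norm)
    \<comment> \<open>On \<open>M\<close> the subtracted combination of the \<open>A i\<close>
      changes the form only by the constant \<open>l0 \<bullet> b\<close>.\<close>
    then have "\<forall>\<^sub>F z in nhds (x n). z \<in> M \<longrightarrow> x n \<bullet> (B n *v x n) \<le> z \<bullet> (B n *v z)"
      unfolding B_def M_def[symmetric]
      by eventually_elim (simp add: lagrangian_quadratic_form[OF M] xM)
    from mult[OF xM _ Bsym this] elim obtain d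
      where d: "s * norm d \<le> norm (coord_proj S (B n *v x n))"
        "coord_proj S ((B n - (\<Sum>i\<in>UNIV. d $ i *\<^sub>R A i)) *v x n) = 0"
      by (auto simp: dist_norm)
    have "norm d * s \<le> norm (B n *v x n)"
      using d(1) norm_coord_proj_le[of S "B n *v x n"] by (simp add: mult.commute)
    then show ?case using d(2) \<open>s > 0\<close> by (auto simp: pos_le_divide_eq)
  qed
  have "(\<lambda>n. norm (B n *v x n) / s) \<longlonglongrightarrow> norm (Q0 *v x0) / s"
    using \<open>s > 0\<close> by (intro tendsto_intros B x) auto
  then have lim_d: "(\<lambda>n. norm (B n *v x n) / s) \<longlonglongrightarrow> 0" using Q0(3) by simp
  obtain d where dx: "\<forall>\<^sub>F n in sequentially. coord_proj S ((B n - (\<Sum>i\<in>UNIV. d n $ i *\<^sub>R A i)) *v x n) = 0"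
    and d: "d \<longlonglongrightarrow> 0"
    using eventually_choose_null_sequence[OF ex_d lim_d] by (elim exE conjE)
  define B' where "B' n = B n - (\<Sum>i\<in>UNIV. d n $ i *\<^sub>R A i)" for n
  have B': "B' \<longlonglongrightarrow> Q0"
  proof -
    have "B' \<longlonglongrightarrow> Q0 - (\<Sum>i\<in>UNIV. 0 $ i *\<^sub>R A i)"
      unfolding B'_def[abs_def] by (intro tendsto_intros B tendsto_vec_nth d)
    then show ?thesis by simp
  qed
  define p where "p n = B' n *v x n" for n
  have "p \<longlonglongrightarrow> Q0 *v x0" unfolding p_def[abs_def] by (intro tendsto_intros B' x)
  then have p: "p \<longlonglongrightarrow> 0" using Q0(3) by simp
  have supp: "\<forall>\<^sub>F n in sequentially. supp (x n) = S \<and> (\<forall>i\<in>S. p n $ i = 0)"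
    using eventually_supp_eq[OF x xE] dx
    by eventually_elim (auto simp: S_def p_def B'_def coord_proj_def vec_eq_iff split: if_splits)
  define y where "y n = (\<chi> i. inverse (x n $ i))" for n
  have ex_Z: "\<forall>\<^sub>F n in sequentially. \<exists>Z. (psd Z \<and> (real k *\<^sub>R diag_part Z - Z) *v x n = p n)
      \<and> norm Z \<le> norm (p n) * (norm (y n) + 1)\<^sup>2"
    using supp
  proof eventually_elim
    case (elim n)
    then have "l0norm (x n) = k" by (simp add: l0norm_def k_def S_def)
    then show ?case
      using support_multiplier[of "x n" "p n"] elim \<open>k > 0\<close> unfolding y_def by auto
  qed
  have "(\<lambda>n. norm (p n) * (norm (y n) + 1)\<^sup>2)
      \<longlonglongrightarrow> norm (0 :: real^'n) * (norm (\<chi> i. inverse (x0 $ i)) + 1)\<^sup>2"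
    unfolding y_def by (intro tendsto_intros p tendsto_entrywise_inverse x xE)
  then have lim_Z: "(\<lambda>n. norm (p n) * (norm (y n) + 1)\<^sup>2) \<longlonglongrightarrow> 0" by simp
  obtain Z where Zx: "\<forall>\<^sub>F n in sequentially. psd (Z n) \<and> (real k *\<^sub>R diag_part (Z n) - Z n) *v x n = p n"
    and Z: "Z \<longlonglongrightarrow> 0"
    using eventually_choose_null_sequence[OF ex_Z lim_Z] by (elim exE conjE)
  define Qt where "Qt n = B' n - (real k *\<^sub>R diag_part (Z n) - Z n)" for n
  have "Qt \<longlonglongrightarrow> Q0 - (real k *\<^sub>R diag_part 0 - 0)"
    unfolding Qt_def[abs_def] by (intro tendsto_intros B' Z)
  then have Qt: "Qt \<longlonglongrightarrow> Q0" by (simp add: linear_0[OF linear_diag_part])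
  have ker_Qt: "\<forall>\<^sub>F n in sequentially. Qt n \<in> sym_mats \<and> Qt n *v x n = 0"
    using Zx
  proof eventually_elim
    case (elim n)
    have "B' n \<in> sym_mats" unfolding B'_def by (intro sym_mats_intros Bsym A)
    moreover have "Z n \<in> sym_mats" using elim by (simp add: psd_def)
    ultimately have "Qt n \<in> sym_mats"
      unfolding Qt_def by (intro sym_mats_intros diag_part_sym)
    then show ?case using elim by (simp add: Qt_def matrix_vector_mult_diff_rdistrib[of "B' n"] p_def)
  qed
  have "\<forall>\<^sub>F n in sequentially. psd (Qt n) \<and> (\<forall>v. v \<bullet> (Qt n *v v) = 0 \<longrightarrow> (\<exists>a. v = a *\<^sub>R x n))"
    by (rule eventually_psd[OF Q0(2) _ \<open>x0 \<noteq> 0\<close> Qt x ker_Qt]) (rule ker)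
  then show ?thesis using supp Zx
  proof eventually_elim
    case (elim n)
    define l where "l = l0 + d n"
    have B'_eq: "B' n = C n - m n *\<^sub>R mat 1 - (\<Sum>i\<in>UNIV. l $ i *\<^sub>R A i)"
      by (simp add: B'_def B_def l_def scaleR_left_distrib sum.distrib)
    have "x n \<bullet> p n = 0"
      unfolding inner_vec_def using elim by (intro sum.neutral) (auto simp: supp_def)
    then have compl: "x n \<bullet> (B' n *v x n) = 0" by (simp add: p_def)
    have "l0norm (x n) = k" using elim by (simp add: l0norm_def k_def S_def)
    moreover have "psd (Qt n)" "psd (Z n)" using elim by simp_all
    moreover have "\<exists>a. v = a *\<^sub>R x n" if "v \<bullet> (Qt n *v v) = 0" for v using elim that by simp
    ultimately show ?case
      using compl M[OF xM] m_def[of n] unfolding k_def[symmetric] Qt_def B'_eq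
      by (intro exact_if_dual_certificate[where x = "x n" and m = "m n" and l = l and Z = "Z n"])
  qed
qed

section \<open>From sequences to a neighborhood\<close>

theorem theorem3p1:
  fixes C0 :: "real^'n^'n"
    and A :: "'m::finite \<Rightarrow> real^'n^'n"
    and b :: "real^'m"
    and k :: nat
    and x0 :: "real^'n"
    and l0 :: "real^'m"
    and Z0 :: "real^'n^'n"
  assumes "C0 \<in> sym_mats"
    and "\<And>i. A i \<in> sym_mats"
    and "val_D C0 A b k = val_Q C0 A b k"
    and "val_Q C0 A b k = val_P C0 A b k"
    and "optimal_P C0 A b k x0"
    and "optimal_D C0 A b k (l0, Z0)"
    and "l0norm x0 = k"
    and "ACQ A b (supp x0) x0"
    and "Z0 = 0"
    and "corank (C0 - (\<Sum>i\<in>UNIV. l0 $ i *\<^sub>R A i)) = 1"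
  shows "locally_stable C0 A b k"
proof (cases "k = 0")
  \<comment> \<open>Here \<open>x0 = 0\<close> spans no line, but every objective is exact, so all
    of \<open>sym_mats\<close> serves as the neighborhood.\<close>
  case True
  then show ?thesis
    using assms(1) exact_zero unfolding locally_stable_def by (intro exI[of _ sym_mats]) auto
next
  case False
  define Q0 where "Q0 = C0 - (\<Sum>i\<in>UNIV. l0 $ i *\<^sub>R A i)"
  have feas: "P_feasible A b k x0" and minP: "\<And>y. P_feasible A b k y \<Longrightarrow> P_obj C0 x0 \<le> P_obj C0 y"
    using assms(5) by (auto simp: optimal_P_def is_arg_min_linorder)
  have D: "D_feasible C0 A k (l0, 0) \<and> (\<forall>q. D_feasible C0 A k q \<longrightarrow> D_obj b q \<le> D_obj b (l0, 0 :: real^'n^'n))"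
    using assms(6) unfolding optimal_D_def is_arg_max_linorder assms(9) .
  note dfeas = conjunct1[OF D] and maxD = conjunct2[OF D, rule_format]
  have "val_P C0 A b k = ereal (P_obj C0 x0)"
    unfolding val_P_def
  proof (rule antisym)
    show "(INF x\<in>{x. P_feasible A b k x}. ereal (P_obj C0 x)) \<le> ereal (P_obj C0 x0)"
      using feas by (intro INF_lower) simp
    show "ereal (P_obj C0 x0) \<le> (INF x\<in>{x. P_feasible A b k x}. ereal (P_obj C0 x))"
      using minP by (intro INF_greatest) simp
  qed
  moreover have "val_D C0 A b k = ereal (D_obj b (l0, 0 :: real^'n^'n))"
    unfolding val_D_def
  proof (rule antisym)
    show "ereal (D_obj b (l0, 0 :: real^'n^'n)) \<le> (SUP q\<in>{q. D_feasible C0 A k q}. ereal (D_obj b q))"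
      using dfeas by (intro SUP_upper) simp
    show "(SUP q\<in>{q. D_feasible C0 A k q}. ereal (D_obj b q)) \<le> ereal (D_obj b (l0, 0 :: real^'n^'n))"
      using maxD by (intro SUP_least) simp
  qed
  ultimately have opt: "x0 \<bullet> (C0 *v x0) = l0 \<bullet> b"
    using assms(3,4) by (simp add: P_obj_def D_obj_def inner_vec_def[of l0])
  have xA: "x0 \<bullet> (A i *v x0) = b $ i" for i using feas by (simp add: P_feasible_def)
  have psd: "psd Q0"
    using dfeas by (simp add: D_feasible_def psd_ge_def Q0_def linear_0[OF linear_diag_part])
  \<comment> \<open>Complementary slackness: this form is the duality gap between \<open>x0\<close>
    and \<open>l0\<close>.\<close>
  have "x0 \<bullet> (Q0 *v x0) = 0"
    unfolding Q0_def using lagrangian_quadratic_form[OF xA] opt by simp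
  then have Qx: "Q0 *v x0 = 0" by (rule psd_null[OF psd])
  have "x0 \<noteq> 0" using False assms(7) by (auto simp: l0norm_def supp_def)
  have ker: "\<exists>a. v = a *\<^sub>R x0" if "Q0 *v v = 0" for v
    using corank_one_null[OF _ _ Qx \<open>x0 \<noteq> 0\<close> that] psd assms(10) by (simp add: psd_def Q0_def)
  show ?thesis
  proof (rule ccontr)
    assume unstable: "\<not> locally_stable C0 A b k"
    \<comment> \<open>Instability supplies inexact objectives at distances below
      \<open>1 / (n + 1)\<close>, a sequence that eventual exactness contradicts.\<close>
    have "\<exists>C\<in>sym_mats. dist C C0 < inverse (real (Suc n)) \<and> \<not> exact C A b k" for n
    proof (rule ccontr)
      assume none: "\<not> (\<exists>C\<in>sym_mats. dist C C0 < inverse (real (Suc n)) \<and> \<not> exact C A b k)"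
      have "\<forall>C\<in>sym_mats \<inter> ball C0 (inverse (real (Suc n))). exact C A b k"
        using none by (auto simp: dist_commute)
      moreover have "C0 \<in> sym_mats \<inter> ball C0 (inverse (real (Suc n)))" using assms(1) by simp
      moreover have "openin (top_of_set sym_mats) (sym_mats \<inter> ball C0 (inverse (real (Suc n))))"
        by (intro openin_open_Int open_ball)
      ultimately show False using unstable unfolding locally_stable_def by blast
    qed
    then obtain C where C: "\<And>n. C n \<in> sym_mats" "\<And>n. dist (C n) C0 < inverse (real (Suc n))"
      and not: "\<And>n. \<not> exact (C n) A b k"
      by metis
    have "(\<lambda>n. dist (C n) C0) \<longlonglongrightarrow> 0"
    proof (rule Lim_null_comparison[OF always_eventually LIMSEQ_inverse_real_of_nat], rule allI)
      show "norm (dist (C n) C0) \<le> inverse (real (Suc n))" for n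
        using less_imp_le[OF C(2)[of n]] by simp
    qed
    then have "C \<longlonglongrightarrow> C0" by (rule tendsto_dist_iff[THEN iffD2])
    have "\<forall>\<^sub>F n in sequentially. exact (C n) A b (l0norm x0)"
      by (rule eventually_exact[OF _ assms(8) xA \<open>x0 \<noteq> 0\<close> Q0_def psd Qx _ \<open>C \<longlonglongrightarrow> C0\<close> C(1)])
         (use assms(2) ker in auto)
    then show False using not assms(7) by simp
  qed
qed

end
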